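(* (i) Let $(A,\mu)$ be an associative algebra and $\alpha,\beta:A\to A$ two commuting algebra endomorphisms. Define a new multiplication $\mu_{(\alpha,\beta)}:=\mu\circ(\alpha\otimes\beta):A\otimes A\to A$. Then $(A,\mu_{(\alpha,\beta)},\alpha,\beta)$ is a BiHom-associative algebra, denoted by $A_{(\alpha,\beta)}$. If $A$ is unital with unit $1_A$, then $A_{(\alpha,\beta)}$ is also unital with unit $1_A$. (ii) Let $(C,\Delta)$ be a coassociative coalgebra and $\psi,\omega:C\to C$ two commuting coalgebra endomorphisms. Define a new comultiplication $\Delta_{(\psi,\omega)}:=(\omega\otimes\psi)\circ\Delta:C\to C\otimes C$. Then $(C,\Delta_{(\psi,\omega)},\psi,\omega)$ is a BiHom-coassociative coalgebra, denoted by $C_{(\psi,\omega)}$. If $C$ is counital with counit $\varepsilon_C$, then $C_{(\psi,\omega)}$ is also counital with counit $\varepsilon_C$. (iii) Let $(H,\mu,\Delta)$ be a bialgebra and $\alpha,\beta,\psi,\omega:H\to H$ bialgebra endomorphisms such that any two of them commute. If $\mu_{(\alpha,\beta)}:=\mu\circ(\alpha\otimes\beta)$ and $\Delta_{(\psi,\omega)}:=(\omega\otimes\psi)\circ\Delta$ are defined as in (i) and (ii), then $H_{(\alpha,\beta,\psi,\omega)}:=(H,\mu_{(\alpha,\beta)},\Delta_{(\psi,\omega)},\alpha,\beta,\psi,\omega)$ is a BiHom-bialgebra.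
   Context: All vector spaces are over a field $\Bbbk$. Algebras and coalgebras are not assumed unital or counital unless stated. Multiplications are written by juxtaposition and $\Delta(c)=c_1\otimes c_2$ (Sweedler). A BiHom-associative algebra $(A,\mu,\alpha,\beta)$: $\mu:A\otimes A\to A$, $\alpha,\beta:A\to A$ linear with $\alpha\beta=\beta\alpha$, $\alpha(aa')=\alpha(a)\alpha(a')$, $\beta(aa')=\beta(a)\beta(a')$, $\alpha(a)(a'a'')=(aa')\beta(a'')$ for all $a,a',a''$. It is unital with unit $1_A\in A$ if $\alpha(1_A)=\beta(1_A)=1_A$, $a1_A=\alpha(a)$ and $1_Aa=\beta(a)$ for all $a$. A BiHom-coassociative coalgebra $(C,\Delta,\psi,\omega)$: $\Delta:C\to C\otimes C$, $\psi,\omega:C\to C$ linear with $\psi\omega=\omega\psi$, $(\psi\otimes\psi)\Delta=\Delta\psi$, $(\omega\otimes\omega)\Delta=\Delta\omega$, $(\Delta\otimes\psi)\Delta=(\omega\otimes\Delta)\Delta$. It is counital with counit $\varepsilon:C\to\Bbbk$ (a linear map) if $\varepsilon\psi=\varepsilon$, $\varepsilon\omega=\varepsilon$, $(\mathrm{id}_C\otimes\varepsilon)\Delta=\omega$, $(\varepsilon\otimes\mathrm{id}_C)\Delta=\psi$. A BiHom-bialgebra $(H,\mu,\Delta,\alpha,\beta,\psi,\omega)$: $(H,\mu,\alpha,\beta)$ is a BiHom-associative algebra, $(H,\Delta,\psi,\omega)$ is a BiHom-coassociative coalgebra, $\Delta(hh')=h_1h'_1\otimes h_2h'_2$, each of $\alpha,\beta$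 commutes with each of $\psi,\omega$, $(\alpha\otimes\alpha)\Delta=\Delta\alpha$, $(\beta\otimes\beta)\Delta=\Delta\beta$, and $\psi(hh')=\psi(h)\psi(h')$, $\omega(hh')=\omega(h)\omega(h')$ for all $h,h'\in H$.
   Formalization: In the unital claim of (i) the endomorphisms α, β are assumed to fix 1_A, and in the counital claim of (ii) ψ, ω are assumed to preserve ε_C; without this the claims fail (e.g. zero endomorphisms), and these conditions are necessary for the conclusion. *)

theory Defs
  imports "HOL-Algebra.Module" "HOL-Algebra.AbelCoset"
begin

text \<open>
  Vector spaces are modules over a field in the sense of HOL-Algebra. Maps between them are HOL
  functions, and all conditions on maps are relativised to the carriers.
\<close>

locale vec_space = module R M + field R for R (structure) and M (structure)

definition linear_map ::
  "('k, 'r) ring_scheme \<Rightarrow> ('k, 'a, 'm) module_scheme \<Rightarrow> ('k, 'b, 'n) module_scheme \<Rightarrow> ('a \<Rightarrow> 'b) \<Rightarrow> bool"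
  where "linear_map R M N f \<longleftrightarrow>
    f \<in> carrier M \<rightarrow> carrier N \<and>
    (\<forall>x \<in> carrier M. \<forall>y \<in> carrier M. f (x \<oplus>\<^bsub>M\<^esub> y) = f x \<oplus>\<^bsub>N\<^esub> f y) \<and>
    (\<forall>k \<in> carrier R. \<forall>x \<in> carrier M. f (k \<odot>\<^bsub>M\<^esub> x) = k \<odot>\<^bsub>N\<^esub> f x)"

definition commute_on :: "('k, 'a, 'm) module_scheme \<Rightarrow> ('a \<Rightarrow> 'a) \<Rightarrow> ('a \<Rightarrow> 'a) \<Rightarrow> bool"
  where "commute_on M f g \<longleftrightarrow> (\<forall>x \<in> carrier M. f (g x) = g (f x))"

definition ground_space :: "('k, 'r) ring_scheme \<Rightarrow> ('k, 'k) module"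
  where "ground_space R =
    \<lparr>carrier = carrier R, mult = mult R, one = one R, zero = zero R, add = add R, smult = mult R\<rparr>"


section \<open>Tensor products\<close>

text \<open>
  The tensor product of \<open>M\<close> and \<open>N\<close> is the free vector space on \<open>carrier M \<times> carrier N\<close> modulo the
  subspace generated by the bilinearity relations; its elements are cosets. The ring fields
  \<open>mult\<close> and \<open>one\<close> of the module records below play no role.
\<close>

definition free_space :: "('k, 'r) ring_scheme \<Rightarrow> 's set \<Rightarrow> ('k, 's \<Rightarrow> 'k) module"
  where "free_space R S =
    \<lparr>carrier = {v. (\<forall>x \<in> S. v x \<in> carrier R) \<and> (\<forall>x. x \<notin> S \<longrightarrow> v x = \<zero>\<^bsub>R\<^esub>) \<and> finite {x. v x \<noteq> \<zero>\<^bsub>R\<^esub>}},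
      mult = undefined, one = undefined,
      zero = (\<lambda>x. \<zero>\<^bsub>R\<^esub>),
      add = (\<lambda>v w x. v x \<oplus>\<^bsub>R\<^esub> w x),
      smult = (\<lambda>k v x. k \<otimes>\<^bsub>R\<^esub> v x)\<rparr>"

definition free_basis :: "('k, 'r) ring_scheme \<Rightarrow> 's \<Rightarrow> ('s \<Rightarrow> 'k)"
  where "free_basis R s = (\<lambda>x. if x = s then \<one>\<^bsub>R\<^esub> else \<zero>\<^bsub>R\<^esub>)"

definition submodule_generated ::
  "('k, 'r) ring_scheme \<Rightarrow> ('k, 'a) module \<Rightarrow> 'a set \<Rightarrow> 'a set"
  where "submodule_generated R M X = \<Inter> {W. submodule W R M \<and> X \<subseteq> W}"

definition quotient_space :: "('k, 'a) module \<Rightarrow> 'a set \<Rightarrow> ('k, 'a set) module"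
  where "quotient_space M W =
    \<lparr>carrier = a_rcosets\<^bsub>M\<^esub> W,
      mult = undefined, one = undefined,
      zero = W,
      add = set_add M,
      smult = (\<lambda>k T. \<Union>v \<in> T. W +>\<^bsub>M\<^esub> (k \<odot>\<^bsub>M\<^esub> v))\<rparr>"

definition pair_space ::
  "('k, 'r) ring_scheme \<Rightarrow> ('k, 'a, 'm) module_scheme \<Rightarrow> ('k, 'b, 'n) module_scheme \<Rightarrow> ('k, 'a \<times> 'b \<Rightarrow> 'k) module"
  where "pair_space R M N = free_space R (carrier M \<times> carrier N)"

definition bilinear_rels ::
  "('k, 'r) ring_scheme \<Rightarrow> ('k, 'a, 'm) module_scheme \<Rightarrow> ('k, 'b, 'n) module_scheme \<Rightarrow> ('a \<times> 'b \<Rightarrow> 'k) set"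
  where "bilinear_rels R M N =
    (let F = pair_space R M N; e = (\<lambda>m n. free_basis R (m, n)) in
      {e (m \<oplus>\<^bsub>M\<^esub> m') n \<ominus>\<^bsub>F\<^esub> (e m n \<oplus>\<^bsub>F\<^esub> e m' n) | m m' n.
          m \<in> carrier M \<and> m' \<in> carrier M \<and> n \<in> carrier N} \<union>
      {e m (n \<oplus>\<^bsub>N\<^esub> n') \<ominus>\<^bsub>F\<^esub> (e m n \<oplus>\<^bsub>F\<^esub> e m n') | m n n'.
          m \<in> carrier M \<and> n \<in> carrier N \<and> n' \<in> carrier N} \<union>
      {e (k \<odot>\<^bsub>M\<^esub> m) n \<ominus>\<^bsub>F\<^esub> k \<odot>\<^bsub>F\<^esub> e m n | k m n.
          k \<in> carrier R \<and> m \<in> carrier M \<and> n \<in> carrier N} \<union>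
      {e m (k \<odot>\<^bsub>N\<^esub> n) \<ominus>\<^bsub>F\<^esub> k \<odot>\<^bsub>F\<^esub> e m n | k m n.
          k \<in> carrier R \<and> m \<in> carrier M \<and> n \<in> carrier N})"

definition bilinear_subspace ::
  "('k, 'r) ring_scheme \<Rightarrow> ('k, 'a, 'm) module_scheme \<Rightarrow> ('k, 'b, 'n) module_scheme \<Rightarrow> ('a \<times> 'b \<Rightarrow> 'k) set"
  where "bilinear_subspace R M N = submodule_generated R (pair_space R M N) (bilinear_rels R M N)"

definition tensor ::
  "('k, 'r) ring_scheme \<Rightarrow> ('k, 'a, 'm) module_scheme \<Rightarrow> ('k, 'b, 'n) module_scheme
    \<Rightarrow> ('k, ('a \<times> 'b \<Rightarrow> 'k) set) module"
  where "tensor R M N = quotient_space (pair_space R M N) (bilinear_subspace R M N)"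

definition pure ::
  "('k, 'r) ring_scheme \<Rightarrow> ('k, 'a, 'm) module_scheme \<Rightarrow> ('k, 'b, 'n) module_scheme
    \<Rightarrow> 'a \<Rightarrow> 'b \<Rightarrow> ('a \<times> 'b \<Rightarrow> 'k) set"
  where "pure R M N m n = bilinear_subspace R M N +>\<^bsub>pair_space R M N\<^esub> free_basis R (m, n)"

text \<open>
  \<open>tensor_lift R P f\<close> is the linear map to \<open>P\<close> induced by a bilinear map \<open>f\<close>: it sends the class of
  \<open>\<Sum> v (m, n) (m, n)\<close> to \<open>\<Sum> v (m, n) f m n\<close>. The chosen representative is irrelevant precisely
  because \<open>f\<close> is bilinear; for other \<open>f\<close> the value is meaningless.
\<close>

definition tensor_lift ::
  "('k, 'r) ring_scheme \<Rightarrow> ('k, 'c, 'p) module_scheme \<Rightarrow> ('a \<Rightarrow> 'b \<Rightarrow> 'c) \<Rightarrow> ('a \<times> 'b \<Rightarrow> 'k) set \<Rightarrow> 'c"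
  where "tensor_lift R P f T =
    (let v = (SOME v. v \<in> T) in
      \<Oplus>\<^bsub>P\<^esub>x \<in> {x. v x \<noteq> \<zero>\<^bsub>R\<^esub>}. v x \<odot>\<^bsub>P\<^esub> f (fst x) (snd x))"

text \<open>\<open>tensor_map R M N f g\<close> is \<open>f \<otimes> g\<close>, where \<open>M\<close> and \<open>N\<close> are the codomains of \<open>f\<close> and \<open>g\<close>.\<close>

definition tensor_map ::
  "('k, 'r) ring_scheme \<Rightarrow> ('k, 'a, 'm) module_scheme \<Rightarrow> ('k, 'b, 'n) module_scheme
    \<Rightarrow> ('c \<Rightarrow> 'a) \<Rightarrow> ('d \<Rightarrow> 'b) \<Rightarrow> ('c \<times> 'd \<Rightarrow> 'k) set \<Rightarrow> ('a \<times> 'b \<Rightarrow> 'k) set"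
  where "tensor_map R M N f g = tensor_lift R (tensor R M N) (\<lambda>x y. pure R M N (f x) (g y))"

text \<open>
  The canonical isomorphisms \<open>(L \<otimes> M) \<otimes> N \<cong> L \<otimes> (M \<otimes> N)\<close>, \<open>M \<otimes> k \<cong> M\<close> and \<open>k \<otimes> M \<cong> M\<close>, which are
  suppressed in informal notation.
\<close>

definition tensor_assoc ::
  "('k, 'r) ring_scheme \<Rightarrow> ('k, 'a, 'l) module_scheme \<Rightarrow> ('k, 'b, 'm) module_scheme \<Rightarrow> ('k, 'c, 'n) module_scheme
    \<Rightarrow> (('a \<times> 'b \<Rightarrow> 'k) set \<times> 'c \<Rightarrow> 'k) set \<Rightarrow> ('a \<times> ('b \<times> 'c \<Rightarrow> 'k) set \<Rightarrow> 'k) set"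
  where "tensor_assoc R L M N =
    (let MN = tensor R M N; P = tensor R L MN in
      tensor_lift R P (\<lambda>t z. tensor_lift R P (\<lambda>x y. pure R L MN x (pure R M N y z)) t))"

definition right_unitor ::
  "('k, 'r) ring_scheme \<Rightarrow> ('k, 'a, 'm) module_scheme \<Rightarrow> ('a \<times> 'k \<Rightarrow> 'k) set \<Rightarrow> 'a"
  where "right_unitor R M = tensor_lift R M (\<lambda>x k. k \<odot>\<^bsub>M\<^esub> x)"

definition left_unitor ::
  "('k, 'r) ring_scheme \<Rightarrow> ('k, 'a, 'm) module_scheme \<Rightarrow> ('k \<times> 'a \<Rightarrow> 'k) set \<Rightarrow> 'a"
  where "left_unitor R M = tensor_lift R M (\<lambda>k x. k \<odot>\<^bsub>M\<^esub> x)"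


section \<open>Algebras\<close>

text \<open>
  Algebras and coalgebras need not have a (co)unit. Where a unit or counit is present, its
  endomorphisms are required to preserve it; without this the unital and counital claims about
  twisted structures fail, since a BiHom unit is by definition fixed by both structure maps.

  A multiplication is a linear map \<open>mu\<close> on the tensor square; \<open>prd R A mu a b\<close> is the product \<open>ab\<close>.
\<close>

definition prd ::
  "('k, 'r) ring_scheme \<Rightarrow> ('k, 'a, 'm) module_scheme \<Rightarrow> (('a \<times> 'a \<Rightarrow> 'k) set \<Rightarrow> 'a) \<Rightarrow> 'a \<Rightarrow> 'a \<Rightarrow> 'a"
  where "prd R A mu a b = mu (pure R A A a b)"

definition multiplicative ::
  "('k, 'r) ring_scheme \<Rightarrow> ('k, 'a, 'm) module_scheme \<Rightarrow> (('a \<times> 'a \<Rightarrow> 'k) set \<Rightarrow> 'a) \<Rightarrow> ('a \<Rightarrow> 'a) \<Rightarrow> bool"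
  where "multiplicative R A mu f \<longleftrightarrow>
    (\<forall>a \<in> carrier A. \<forall>b \<in> carrier A. f (prd R A mu a b) = prd R A mu (f a) (f b))"

locale assoc_algebra = vec_space R A for R (structure) and A (structure) +
  fixes mu
  assumes mu_linear: "linear_map R (tensor R A A) A mu"
    and mu_assoc: "\<lbrakk>a \<in> carrier A; b \<in> carrier A; c \<in> carrier A\<rbrakk> \<Longrightarrow>
      prd R A mu a (prd R A mu b c) = prd R A mu (prd R A mu a b) c"

locale unital_assoc_algebra = assoc_algebra +
  fixes u
  assumes unit_closed: "u \<in> carrier A"
    and unit_right: "a \<in> carrier A \<Longrightarrow> prd R A mu a u = a"
    and unit_left: "a \<in> carrier A \<Longrightarrow> prd R A mu u a = a"

definition algebra_endo ::
  "('k, 'r) ring_scheme \<Rightarrow> ('k, 'a, 'm) module_scheme \<Rightarrow> (('a \<times> 'a \<Rightarrow> 'k) set \<Rightarrow> 'a) \<Rightarrow> ('a \<Rightarrow> 'a) \<Rightarrow> bool"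
  where "algebra_endo R A mu f \<longleftrightarrow> linear_map R A A f \<and> multiplicative R A mu f"

definition unital_algebra_endo ::
  "('k, 'r) ring_scheme \<Rightarrow> ('k, 'a, 'm) module_scheme \<Rightarrow> (('a \<times> 'a \<Rightarrow> 'k) set \<Rightarrow> 'a) \<Rightarrow> 'a \<Rightarrow> ('a \<Rightarrow> 'a) \<Rightarrow> bool"
  where "unital_algebra_endo R A mu u f \<longleftrightarrow> algebra_endo R A mu f \<and> f u = u"

locale bihom_assoc_algebra = vec_space R A for R (structure) and A (structure) +
  fixes mu alpha beta
  assumes mu_linear: "linear_map R (tensor R A A) A mu"
    and alpha_linear: "linear_map R A A alpha"
    and beta_linear: "linear_map R A A beta"
    and alpha_beta: "commute_on A alpha beta"
    and alpha_mult: "multiplicative R A mu alpha"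
    and beta_mult: "multiplicative R A mu beta"
    and bihom_assoc: "\<lbrakk>a \<in> carrier A; b \<in> carrier A; c \<in> carrier A\<rbrakk> \<Longrightarrow>
      prd R A mu (alpha a) (prd R A mu b c) = prd R A mu (prd R A mu a b) (beta c)"

locale unital_bihom_assoc_algebra = bihom_assoc_algebra +
  fixes u
  assumes unit_closed: "u \<in> carrier A"
    and alpha_unit: "alpha u = u"
    and beta_unit: "beta u = u"
    and unit_right: "a \<in> carrier A \<Longrightarrow> prd R A mu a u = alpha a"
    and unit_left: "a \<in> carrier A \<Longrightarrow> prd R A mu u a = beta a"

definition twisted_mult ::
  "('k, 'r) ring_scheme \<Rightarrow> ('k, 'a, 'm) module_scheme \<Rightarrow> (('a \<times> 'a \<Rightarrow> 'k) set \<Rightarrow> 'a)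
    \<Rightarrow> ('a \<Rightarrow> 'a) \<Rightarrow> ('a \<Rightarrow> 'a) \<Rightarrow> ('a \<times> 'a \<Rightarrow> 'k) set \<Rightarrow> 'a"
  where "twisted_mult R A mu alpha beta = mu \<circ> tensor_map R A A alpha beta"


section \<open>Coalgebras\<close>

definition comultiplicative ::
  "('k, 'r) ring_scheme \<Rightarrow> ('k, 'c, 'm) module_scheme \<Rightarrow> ('c \<Rightarrow> ('c \<times> 'c \<Rightarrow> 'k) set) \<Rightarrow> ('c \<Rightarrow> 'c) \<Rightarrow> bool"
  where "comultiplicative R C Delta f \<longleftrightarrow>
    (\<forall>c \<in> carrier C. tensor_map R C C f f (Delta c) = Delta (f c))"

locale coassoc_coalgebra = vec_space R C for R (structure) and C (structure) +
  fixes Delta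
  assumes Delta_linear: "linear_map R C (tensor R C C) Delta"
    and Delta_coassoc: "c \<in> carrier C \<Longrightarrow>
      tensor_assoc R C C C (tensor_map R (tensor R C C) C Delta id (Delta c)) =
      tensor_map R C (tensor R C C) id Delta (Delta c)"

locale counital_coassoc_coalgebra = coassoc_coalgebra +
  fixes eps
  assumes eps_linear: "linear_map R C (ground_space R) eps"
    and counit_right: "c \<in> carrier C \<Longrightarrow>
      right_unitor R C (tensor_map R C (ground_space R) id eps (Delta c)) = c"
    and counit_left: "c \<in> carrier C \<Longrightarrow>
      left_unitor R C (tensor_map R (ground_space R) C eps id (Delta c)) = c"

definition coalgebra_endo ::
  "('k, 'r) ring_scheme \<Rightarrow> ('k, 'c, 'm) module_scheme \<Rightarrow> ('c \<Rightarrow> ('c \<times> 'c \<Rightarrow> 'k) set) \<Rightarrow> ('c \<Rightarrow> 'c) \<Rightarrow> bool"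
  where "coalgebra_endo R C Delta f \<longleftrightarrow> linear_map R C C f \<and> comultiplicative R C Delta f"

definition counital_coalgebra_endo ::
  "('k, 'r) ring_scheme \<Rightarrow> ('k, 'c, 'm) module_scheme \<Rightarrow> ('c \<Rightarrow> ('c \<times> 'c \<Rightarrow> 'k) set) \<Rightarrow> ('c \<Rightarrow> 'k)
    \<Rightarrow> ('c \<Rightarrow> 'c) \<Rightarrow> bool"
  where "counital_coalgebra_endo R C Delta eps f \<longleftrightarrow>
    coalgebra_endo R C Delta f \<and> (\<forall>c \<in> carrier C. eps (f c) = eps c)"

locale bihom_coassoc_coalgebra = vec_space R C for R (structure) and C (structure) +
  fixes Delta psi omega
  assumes Delta_linear: "linear_map R C (tensor R C C) Delta"
    and psi_linear: "linear_map R C C psi"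
    and omega_linear: "linear_map R C C omega"
    and psi_omega: "commute_on C psi omega"
    and psi_comult: "comultiplicative R C Delta psi"
    and omega_comult: "comultiplicative R C Delta omega"
    and bihom_coassoc: "c \<in> carrier C \<Longrightarrow>
      tensor_assoc R C C C (tensor_map R (tensor R C C) C Delta psi (Delta c)) =
      tensor_map R C (tensor R C C) omega Delta (Delta c)"

locale counital_bihom_coassoc_coalgebra = bihom_coassoc_coalgebra +
  fixes eps
  assumes eps_linear: "linear_map R C (ground_space R) eps"
    and eps_psi: "c \<in> carrier C \<Longrightarrow> eps (psi c) = eps c"
    and eps_omega: "c \<in> carrier C \<Longrightarrow> eps (omega c) = eps c"
    and counit_right: "c \<in> carrier C \<Longrightarrow>
      right_unitor R C (tensor_map R C (ground_space R) id eps (Delta c)) = omega c"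
    and counit_left: "c \<in> carrier C \<Longrightarrow>
      left_unitor R C (tensor_map R (ground_space R) C eps id (Delta c)) = psi c"

definition twisted_comult ::
  "('k, 'r) ring_scheme \<Rightarrow> ('k, 'c, 'm) module_scheme \<Rightarrow> ('c \<Rightarrow> ('c \<times> 'c \<Rightarrow> 'k) set)
    \<Rightarrow> ('c \<Rightarrow> 'c) \<Rightarrow> ('c \<Rightarrow> 'c) \<Rightarrow> 'c \<Rightarrow> ('c \<times> 'c \<Rightarrow> 'k) set"
  where "twisted_comult R C Delta psi omega = tensor_map R C C omega psi \<circ> Delta"


section \<open>Bialgebras\<close>

text \<open>
  The componentwise product on \<open>H \<otimes> H\<close>, determined by \<open>(x \<otimes> y) (x' \<otimes> y') = xx' \<otimes> yy'\<close>. Thus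
  \<open>tensor_prd R H mu (Delta h) (Delta h')\<close> is \<open>h\<^sub>1h'\<^sub>1 \<otimes> h\<^sub>2h'\<^sub>2\<close> in Sweedler notation.
\<close>

definition tensor_prd ::
  "('k, 'r) ring_scheme \<Rightarrow> ('k, 'h, 'm) module_scheme \<Rightarrow> (('h \<times> 'h \<Rightarrow> 'k) set \<Rightarrow> 'h)
    \<Rightarrow> ('h \<times> 'h \<Rightarrow> 'k) set \<Rightarrow> ('h \<times> 'h \<Rightarrow> 'k) set \<Rightarrow> ('h \<times> 'h \<Rightarrow> 'k) set"
  where "tensor_prd R H mu s t =
    tensor_lift R (tensor R H H) (\<lambda>x y.
      tensor_lift R (tensor R H H) (\<lambda>x' y'. pure R H H (prd R H mu x x') (prd R H mu y y')) t) s"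

definition comult_multiplicative ::
  "('k, 'r) ring_scheme \<Rightarrow> ('k, 'h, 'm) module_scheme \<Rightarrow> (('h \<times> 'h \<Rightarrow> 'k) set \<Rightarrow> 'h)
    \<Rightarrow> ('h \<Rightarrow> ('h \<times> 'h \<Rightarrow> 'k) set) \<Rightarrow> bool"
  where "comult_multiplicative R H mu Delta \<longleftrightarrow>
    (\<forall>h \<in> carrier H. \<forall>h' \<in> carrier H.
      Delta (prd R H mu h h') = tensor_prd R H mu (Delta h) (Delta h'))"

locale bialgebra =
  assoc_algebra R H mu + coassoc_coalgebra R H Delta
  for R (structure) and H (structure) and mu Delta +
  assumes Delta_mult: "comult_multiplicative R H mu Delta"

definition bialgebra_endo ::
  "('k, 'r) ring_scheme \<Rightarrow> ('k, 'h, 'm) module_scheme \<Rightarrow> (('h \<times> 'h \<Rightarrow> 'k) set \<Rightarrow> 'h)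
    \<Rightarrow> ('h \<Rightarrow> ('h \<times> 'h \<Rightarrow> 'k) set) \<Rightarrow> ('h \<Rightarrow> 'h) \<Rightarrow> bool"
  where "bialgebra_endo R H mu Delta f \<longleftrightarrow>
    algebra_endo R H mu f \<and> coalgebra_endo R H Delta f"

locale bihom_bialgebra =
  bihom_assoc_algebra R H mu alpha beta + bihom_coassoc_coalgebra R H Delta psi omega
  for R (structure) and H (structure) and mu Delta alpha beta psi omega +
  assumes Delta_mult: "comult_multiplicative R H mu Delta"
    and alpha_psi: "commute_on H alpha psi"
    and alpha_omega: "commute_on H alpha omega"
    and beta_psi: "commute_on H beta psi"
    and beta_omega: "commute_on H beta omega"
    and alpha_comult: "comultiplicative R H Delta alpha"
    and beta_comult: "comultiplicative R H Delta beta"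
    and psi_mult: "multiplicative R H mu psi"
    and omega_mult: "multiplicative R H mu omega"

end

theory Submission
  imports Defs
begin

text \<open>
  A linear map out of a tensor product is determined by its values on pure tensors and exists for
  every bilinear prescription of these values. Hence \<open>\<otimes>\<close> is functorial, the associator is natural,
  and every identity between composites of such maps may be checked on pure tensors. For the twisted
  comultiplication \<open>\<Delta>' = (\<omega> \<otimes> \<psi>) \<Delta>\<close>, comultiplicativity of \<open>\<psi>\<close> and \<open>\<omega>\<close> gives
  \<open>\<Delta>' \<omega> = (\<omega>\<^sup>2 \<otimes> \<psi>\<omega>) \<Delta>\<close> and \<open>\<Delta>' \<psi> = (\<psi>\<omega> \<otimes> \<psi>\<^sup>2) \<Delta>\<close>, so both sides of BiHom-coassociativity equal
  \<open>(\<omega>\<^sup>2 \<otimes> \<psi>\<omega> \<otimes> \<psi>\<^sup>2)\<close> applied to the two sides of coassociativity. For a bialgebra the twisted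
  componentwise product of \<open>s\<close> and \<open>t\<close> is \<open>(\<alpha> \<otimes> \<alpha>) s \<cdot> (\<beta> \<otimes> \<beta>) t\<close>, and \<open>\<omega> \<otimes> \<psi>\<close> is multiplicative.
\<close>

section \<open>Linear maps and submodules\<close>

lemma linear_mapD:
  assumes "linear_map R M N f"
  shows "x \<in> carrier M \<Longrightarrow> f x \<in> carrier N"
    and "x \<in> carrier M \<Longrightarrow> y \<in> carrier M \<Longrightarrow> f (x \<oplus>\<^bsub>M\<^esub> y) = f x \<oplus>\<^bsub>N\<^esub> f y"
    and "k \<in> carrier R \<Longrightarrow> x \<in> carrier M \<Longrightarrow> f (k \<odot>\<^bsub>M\<^esub> x) = k \<odot>\<^bsub>N\<^esub> f x"
  using assms unfolding linear_map_def by auto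

lemma linear_mapI:
  assumes "\<And>x. x \<in> carrier M \<Longrightarrow> f x \<in> carrier N"
    and "\<And>x y. x \<in> carrier M \<Longrightarrow> y \<in> carrier M \<Longrightarrow> f (x \<oplus>\<^bsub>M\<^esub> y) = f x \<oplus>\<^bsub>N\<^esub> f y"
    and "\<And>k x. k \<in> carrier R \<Longrightarrow> x \<in> carrier M \<Longrightarrow> f (k \<odot>\<^bsub>M\<^esub> x) = k \<odot>\<^bsub>N\<^esub> f x"
  shows "linear_map R M N f"
  using assms unfolding linear_map_def by auto

lemma linear_map_id: "linear_map R M M id"
  by (rule linear_mapI) auto

lemma linear_map_comp:
  assumes "linear_map R M N f" and "linear_map R L M g"
  shows "linear_map R L N (\<lambda>x. f (g x))"
  by (rule linear_mapI) (simp_all add: linear_mapD[OF assms(1)] linear_mapD[OF assms(2)])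

lemma linear_map_zero:
  assumes "module R M" and "module R N" and f: "linear_map R M N f"
  shows "f \<zero>\<^bsub>M\<^esub> = \<zero>\<^bsub>N\<^esub>"
proof -
  interpret M: module R M by fact
  interpret N: module R N by fact
  have "f (\<zero>\<^bsub>R\<^esub> \<odot>\<^bsub>M\<^esub> \<zero>\<^bsub>M\<^esub>) = \<zero>\<^bsub>R\<^esub> \<odot>\<^bsub>N\<^esub> f \<zero>\<^bsub>M\<^esub>"
    by (rule linear_mapD(3)[OF f]) auto
  then show ?thesis
    using linear_mapD(1)[OF f, of "\<zero>\<^bsub>M\<^esub>"] by simp
qed

lemma linear_map_minus:
  assumes "module R M" and "module R N" and f: "linear_map R M N f"
    and x: "x \<in> carrier M" and y: "y \<in> carrier M"
  shows "f (x \<ominus>\<^bsub>M\<^esub> y) = f x \<ominus>\<^bsub>N\<^esub> f y"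
proof -
  interpret M: module R M by fact
  interpret N: module R N by fact
  \<comment> \<open>Adding \<open>f y\<close> back reduces the claim to additivity and cancellation
    in \<open>N\<close>. Compatibility with negation then follows as the case of zero minus
    \<open>x\<close>.\<close>
  have "f (x \<ominus>\<^bsub>M\<^esub> y) \<oplus>\<^bsub>N\<^esub> f y = f (x \<ominus>\<^bsub>M\<^esub> y \<oplus>\<^bsub>M\<^esub> y)"
    using x y by (simp add: linear_mapD(2)[OF f])
  also have "x \<ominus>\<^bsub>M\<^esub> y \<oplus>\<^bsub>M\<^esub> y = x"
    using x y by (simp add: M.M.minus_eq M.M.a_assoc M.M.l_neg)
  finally show ?thesis
    using linear_mapD(1)[OF f] x y
    by (metis M.M.minus_closed N.M.a_assoc N.M.add.inv_closed N.M.minus_eq N.M.r_neg N.M.r_zero)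
qed

text \<open>This drives every density argument below: two linear maps that agree on generators agree
  everywhere, because the equalizer is a submodule containing the generators. With the zero map as
  \<open>g\<close> it covers kernels as well.\<close>

lemma submodule_equalizer:
  assumes "module R M" and "module R N" and f: "linear_map R M N f" and g: "linear_map R M N g"
  shows "submodule {x \<in> carrier M. f x = g x} R M"
proof -
  interpret M: module R M by fact
  interpret N: module R N by fact
  note z = linear_map_zero[OF assms(1,2)]
  have inv: "f (\<ominus>\<^bsub>M\<^esub> x) = \<ominus>\<^bsub>N\<^esub> f x" if "linear_map R M N f" "x \<in> carrier M" for f x
    using linear_map_minus[OF assms(1,2) that(1), of "\<zero>\<^bsub>M\<^esub>" x] z[OF that(1)] that(2)
      linear_mapD(1)[OF that]
    by (simp add: M.M.minus_eq N.M.minus_eq)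
  show ?thesis
    by (rule M.submoduleI)
      (auto simp: linear_mapD[OF f] linear_mapD[OF g] z[OF f] z[OF g] inv[OF f] inv[OF g])
qed

section \<open>Generated submodules\<close>

lemma submodule_generated_incl: "X \<subseteq> submodule_generated R M X"
  unfolding submodule_generated_def by auto

lemma submodule_generated_least:
  assumes "submodule W R M" and "X \<subseteq> W"
  shows "submodule_generated R M X \<subseteq> W"
  using assms unfolding submodule_generated_def by auto

text \<open>The whole carrier is a submodule containing \<open>X\<close>, so the intersection stays
  inside the carrier. The closure properties then pass to the intersection from its members.\<close>

lemma submodule_generated_submodule:
  assumes "module R M" and X: "X \<subseteq> carrier M"
  shows "submodule (submodule_generated R M X) R M"
proof -
  interpret M: module R M by fact
  have "submodule (carrier M) R M"
    by (rule M.submoduleI) auto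
  then have sub: "submodule_generated R M X \<subseteq> carrier M"
    using X by (rule submodule_generated_least)
  have zero: "\<zero>\<^bsub>M\<^esub> \<in> W" if "submodule W R M" for W
    using subgroup.one_closed[OF submodule.axioms(1)[OF that]] by simp
  show ?thesis
  proof (rule M.submoduleI)
    show "submodule_generated R M X \<subseteq> carrier M" by (rule sub)
  qed (simp_all add: submodule_generated_def zero M.submoduleE(3,4,5))
qed

section \<open>Free modules and quotients\<close>

lemma free_space_simps:
  "\<zero>\<^bsub>free_space R S\<^esub> x = \<zero>\<^bsub>R\<^esub>"
  "(v \<oplus>\<^bsub>free_space R S\<^esub> w) x = v x \<oplus>\<^bsub>R\<^esub> w x"
  "(k \<odot>\<^bsub>free_space R S\<^esub> v) x = k \<otimes>\<^bsub>R\<^esub> v x"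
  by (simp_all add: free_space_def)

lemma free_space_coeff:
  assumes "v \<in> carrier (free_space R S)"
  shows "{x. v x \<noteq> \<zero>\<^bsub>R\<^esub>} \<subseteq> S" and "finite {x. v x \<noteq> \<zero>\<^bsub>R\<^esub>}"
    and "x \<in> S \<Longrightarrow> v x \<in> carrier R"
  using assms unfolding free_space_def by auto

text \<open>Outside \<open>S\<close> the coefficients are zero, so membership holds at every point.
  The module laws can therefore be checked pointwise without splitting on
  \<open>x \<in> S\<close>.\<close>

lemma free_space_coeff_closed:
  assumes "cring R" and "v \<in> carrier (free_space R S)"
  shows "v x \<in> carrier R"
proof -
  interpret cring R by fact
  show ?thesis
    using assms(2) unfolding free_space_def by (cases "x \<in> S") auto
qed

text \<open>A finite superset \<open>T\<close> of the support is enough, which avoids computing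
  exact supports of sums and multiples, where cancellation may occur.\<close>

lemma free_space_memI:
  assumes "\<And>x. x \<in> S \<Longrightarrow> v x \<in> carrier R" and "finite T" and "T \<subseteq> S"
    and "\<And>x. x \<notin> T \<Longrightarrow> v x = \<zero>\<^bsub>R\<^esub>"
  shows "v \<in> carrier (free_space R S)"
proof -
  have "finite {x. v x \<noteq> \<zero>\<^bsub>R\<^esub>}"
    by (rule finite_subset[OF _ \<open>finite T\<close>]) (use assms(4) in blast)
  then show ?thesis
    using assms by (auto simp: free_space_def)
qed

lemma free_space_module:
  fixes R :: "('k, 'r) ring_scheme" and S :: "'s set"
  assumes "cring R"
  shows "module R (free_space R S)"
proof -
  interpret R: cring R by fact
  let ?F = "free_space R S"
  note coeff = free_space_coeff_closed[OF \<open>cring R\<close>, where S = S]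
  have add: "v \<oplus>\<^bsub>?F\<^esub> w \<in> carrier ?F" if "v \<in> carrier ?F" "w \<in> carrier ?F" for v w
    using free_space_coeff(1,2)[OF that(1)] free_space_coeff(1,2)[OF that(2)]
    by (intro free_space_memI[of _ _ _ "{x. v x \<noteq> \<zero>\<^bsub>R\<^esub>} \<union> {x. w x \<noteq> \<zero>\<^bsub>R\<^esub>}"])
      (simp_all add: free_space_simps coeff that)
  have smult: "k \<odot>\<^bsub>?F\<^esub> v \<in> carrier ?F" if "k \<in> carrier R" "v \<in> carrier ?F" for k v
    using free_space_coeff(1,2)[OF that(2)]
    by (intro free_space_memI[of _ _ _ "{x. v x \<noteq> \<zero>\<^bsub>R\<^esub>}"])
      (simp_all add: free_space_simps coeff that)
  \<comment> \<open>The additive inverse is supplied as the multiple by minus one, whose membership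
    is an instance of closure under scalars.\<close>
  have neg: "(\<ominus>\<^bsub>R\<^esub> \<one>\<^bsub>R\<^esub>) \<odot>\<^bsub>?F\<^esub> v \<oplus>\<^bsub>?F\<^esub> v = \<zero>\<^bsub>?F\<^esub>" if "v \<in> carrier ?F" for v
    by (simp add: fun_eq_iff free_space_simps coeff[OF that] R.l_minus R.l_neg)
  show ?thesis
  proof (rule moduleI)
    show "abelian_group ?F"
    proof (rule abelian_groupI)
      show "\<zero>\<^bsub>?F\<^esub> \<in> carrier ?F"
        by (rule free_space_memI[of _ _ _ "{}"]) (simp_all add: free_space_simps)
      show "\<exists>w\<in>carrier ?F. w \<oplus>\<^bsub>?F\<^esub> v = \<zero>\<^bsub>?F\<^esub>" if "v \<in> carrier ?F" for v
        using neg[OF that] smult[OF _ that] by blast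
    qed (simp_all add: add fun_eq_iff free_space_simps coeff R.a_ac)
  qed (simp_all add: smult fun_eq_iff free_space_simps coeff R.l_distr R.r_distr R.m_assoc \<open>cring R\<close>)
qed

lemma free_basis_closed:
  assumes "cring R" and "s \<in> S"
  shows "free_basis R s \<in> carrier (free_space R S)"
proof -
  interpret cring R by fact
  show ?thesis
    using assms(2) by (intro free_space_memI[of _ _ _ "{s}"]) (auto simp: free_basis_def)
qed

text \<open>Induction on a finite set containing the support: splitting off one coordinate writes
  \<open>v\<close> as \<open>v s\<close> times a basis vector plus a vector supported on the smaller
  set.\<close>

lemma free_space_eq_basis_span:
  assumes "cring R" and W: "submodule W R (free_space R S)"
    and basis: "\<And>s. s \<in> S \<Longrightarrow> free_basis R s \<in> W"
  shows "W = carrier (free_space R S)"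
proof -
  interpret R: cring R by fact
  interpret F: module R "free_space R S" by (rule free_space_module) fact
  note WE = F.submoduleE[OF W]
  have "v \<in> W" if "finite T" "v \<in> carrier (free_space R S)" "{x. v x \<noteq> \<zero>\<^bsub>R\<^esub>} \<subseteq> T" for v T
    using that
  proof (induction T arbitrary: v rule: finite_induct)
    case empty
    then have "v = \<zero>\<^bsub>free_space R S\<^esub>" by (simp add: fun_eq_iff free_space_simps)
    then show ?case
      using subgroup.one_closed[OF submodule.axioms(1)[OF W]] by simp
  next
    case (insert s T)
    note v = insert.prems(1)
    define w where "w = v(s := \<zero>\<^bsub>R\<^esub>)"
    have w_carr: "w \<in> carrier (free_space R S)"
      using free_space_coeff[OF v]
      by (intro free_space_memI[of _ _ _ "{x. v x \<noteq> \<zero>\<^bsub>R\<^esub>}"]) (simp_all add: w_def)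
    have w_supp: "{x. w x \<noteq> \<zero>\<^bsub>R\<^esub>} \<subseteq> T"
      using insert.prems(2) by (auto simp: w_def)
    note w = insert.IH[OF w_carr w_supp]
    show ?case
    proof (cases "s \<in> S")
      \<comment> \<open>The finite set merely contains the support, so \<open>s\<close> may lie
        outside \<open>S\<close>. Then the coefficient at \<open>s\<close> is already zero and
        \<open>v\<close> equals \<open>w\<close>.\<close>
      case False
      then have "v s = \<zero>\<^bsub>R\<^esub>" using free_space_coeff(1)[OF v] by blast
      then have "v = w" by (simp add: w_def fun_upd_idem)
      then show ?thesis using w by simp
    next
      case True
      have sum: "v s \<odot>\<^bsub>free_space R S\<^esub> free_basis R s \<oplus>\<^bsub>free_space R S\<^esub> w = v"
        using free_space_coeff_closed[OF \<open>cring R\<close> v]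
        by (simp add: fun_eq_iff free_space_simps free_basis_def w_def)
      have "v s \<odot>\<^bsub>free_space R S\<^esub> free_basis R s \<in> W"
        by (rule WE(4)[OF free_space_coeff(3)[OF v True] basis[OF True]])
      from WE(5)[OF this w] show ?thesis
        unfolding sum .
    qed
  qed
  from this[OF free_space_coeff(2) _ subset_refl] have "carrier (free_space R S) \<subseteq> W"
    by (intro subsetI)
  with WE(1) show ?thesis
    by (rule subset_antisym)
qed

section \<open>Linear extension from the basis of a free module\<close>

definition linear_extension ::
  "('k, 'r) ring_scheme \<Rightarrow> ('k, 'c, 'p) module_scheme \<Rightarrow> ('s \<Rightarrow> 'c) \<Rightarrow> ('s \<Rightarrow> 'k) \<Rightarrow> 'c"
  where "linear_extension R P f v = (\<Oplus>\<^bsub>P\<^esub>x \<in> {x. v x \<noteq> \<zero>\<^bsub>R\<^esub>}. v x \<odot>\<^bsub>P\<^esub> f x)"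

context
  fixes R :: "('k, 'r) ring_scheme" and P :: "('k, 'c, 'p) module_scheme"
    and S :: "'s set" and f :: "'s \<Rightarrow> 'c"
  assumes P: "module R P" and f: "f \<in> S \<rightarrow> carrier P"
begin

interpretation P: module R P by (rule P)

text \<open>The additional summands have coefficient zero. This lets sums belonging to different
  vectors be compared over one common index set.\<close>

lemma linear_extension_superset:
  assumes "v \<in> carrier (free_space R S)" and "finite T" and "{x. v x \<noteq> \<zero>\<^bsub>R\<^esub>} \<subseteq> T" and "T \<subseteq> S"
  shows "linear_extension R P f v = (\<Oplus>\<^bsub>P\<^esub>x \<in> T. v x \<odot>\<^bsub>P\<^esub> f x)"
  unfolding linear_extension_def
proof (rule P.add.finprod_mono_neutral_cong_left)
  show "(\<lambda>x. v x \<odot>\<^bsub>P\<^esub> f x) \<in> T \<rightarrow> carrier P"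
    using free_space_coeff(3)[OF assms(1)] assms(4) f by (auto simp: Pi_iff subset_iff)
qed (use assms f in \<open>auto simp: Pi_iff subset_iff\<close>)

lemma linear_extension_basis:
  assumes "s \<in> S"
  shows "linear_extension R P f (free_basis R s) = f s"
proof -
  have "f s \<in> carrier P" using f assms by auto
  have "linear_extension R P f (free_basis R s) = (\<Oplus>\<^bsub>P\<^esub>x \<in> {s}. free_basis R s x \<odot>\<^bsub>P\<^esub> f x)"
    using assms by (intro linear_extension_superset free_basis_closed P.R.is_cring)
      (auto simp: free_basis_def)
  also have "\<dots> = f s"
    using \<open>f s \<in> carrier P\<close> by (simp add: free_basis_def)
  finally show ?thesis .
qed

lemma linear_extension_linear: "linear_map R (free_space R S) P (linear_extension R P f)"
proof -
  interpret F: module R "free_space R S" by (rule free_space_module[OF P.R.is_cring])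
  have summand: "v x \<odot>\<^bsub>P\<^esub> f x \<in> carrier P" if "v \<in> carrier (free_space R S)" "x \<in> S" for v x
    using free_space_coeff(3)[OF that] f that(2) by auto
  show ?thesis
  proof (rule linear_mapI)
    fix v assume v: "v \<in> carrier (free_space R S)"
    show "linear_extension R P f v \<in> carrier P"
      unfolding linear_extension_def
      using free_space_coeff(1)[OF v] summand[OF v] by (intro P.add.finprod_closed) auto
  next
    fix v w assume v: "v \<in> carrier (free_space R S)" and w: "w \<in> carrier (free_space R S)"
    \<comment> \<open>The support of the sum can be strictly smaller than this union because of
      cancellation, so all three extensions are evaluated over the union.\<close>
    let ?T = "{x. v x \<noteq> \<zero>\<^bsub>R\<^esub>} \<union> {x. w x \<noteq> \<zero>\<^bsub>R\<^esub>}"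
    have T: "finite ?T" "?T \<subseteq> S"
      using free_space_coeff(1,2)[OF v] free_space_coeff(1,2)[OF w] by auto
    have "linear_extension R P f (v \<oplus>\<^bsub>free_space R S\<^esub> w)
        = (\<Oplus>\<^bsub>P\<^esub>x \<in> ?T. (v \<oplus>\<^bsub>free_space R S\<^esub> w) x \<odot>\<^bsub>P\<^esub> f x)"
      by (rule linear_extension_superset[OF F.M.a_closed[OF v w] T(1) _ T(2)])
        (auto simp: free_space_simps)
    also have "\<dots> = (\<Oplus>\<^bsub>P\<^esub>x \<in> ?T. v x \<odot>\<^bsub>P\<^esub> f x \<oplus>\<^bsub>P\<^esub> w x \<odot>\<^bsub>P\<^esub> f x)"
    proof (rule P.add.finprod_cong')
      fix x assume "x \<in> ?T"
      then have "x \<in> S" using T(2) by blast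
      then show "(v \<oplus>\<^bsub>free_space R S\<^esub> w) x \<odot>\<^bsub>P\<^esub> f x = v x \<odot>\<^bsub>P\<^esub> f x \<oplus>\<^bsub>P\<^esub> w x \<odot>\<^bsub>P\<^esub> f x"
        using free_space_coeff(3)[OF v] free_space_coeff(3)[OF w] f
        by (auto simp: free_space_simps P.smult_l_distr Pi_iff)
    qed (use T(2) summand v w in auto)
    also have "\<dots> = (\<Oplus>\<^bsub>P\<^esub>x \<in> ?T. v x \<odot>\<^bsub>P\<^esub> f x) \<oplus>\<^bsub>P\<^esub> (\<Oplus>\<^bsub>P\<^esub>x \<in> ?T. w x \<odot>\<^bsub>P\<^esub> f x)"
      by (rule P.add.finprod_multf) (use T(2) summand v w in auto)
    also have "(\<Oplus>\<^bsub>P\<^esub>x \<in> ?T. v x \<odot>\<^bsub>P\<^esub> f x) = linear_extension R P f v"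
      using T by (intro linear_extension_superset[symmetric] v) auto
    also have "(\<Oplus>\<^bsub>P\<^esub>x \<in> ?T. w x \<odot>\<^bsub>P\<^esub> f x) = linear_extension R P f w"
      using T by (intro linear_extension_superset[symmetric] w) auto
    finally show "linear_extension R P f (v \<oplus>\<^bsub>free_space R S\<^esub> w)
        = linear_extension R P f v \<oplus>\<^bsub>P\<^esub> linear_extension R P f w" .
  next
    fix k v assume k: "k \<in> carrier R" and v: "v \<in> carrier (free_space R S)"
    \<comment> \<open>Scaling can shrink the support, for instance when \<open>k\<close> is zero, so
      both sides are evaluated over the support of \<open>v\<close>.\<close>
    let ?T = "{x. v x \<noteq> \<zero>\<^bsub>R\<^esub>}"
    note T = free_space_coeff(1,2)[OF v]
    have "linear_extension R P f (k \<odot>\<^bsub>free_space R S\<^esub> v)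
        = (\<Oplus>\<^bsub>P\<^esub>x \<in> ?T. (k \<odot>\<^bsub>free_space R S\<^esub> v) x \<odot>\<^bsub>P\<^esub> f x)"
      by (rule linear_extension_superset[OF F.smult_closed[OF k v] T(2) _ T(1)])
        (use k in \<open>auto simp: free_space_simps\<close>)
    also have "\<dots> = (\<Oplus>\<^bsub>P\<^esub>x \<in> ?T. k \<odot>\<^bsub>P\<^esub> (v x \<odot>\<^bsub>P\<^esub> f x))"
    proof (rule P.add.finprod_cong')
      fix x assume "x \<in> ?T"
      then have "x \<in> S" using T(1) by blast
      then show "(k \<odot>\<^bsub>free_space R S\<^esub> v) x \<odot>\<^bsub>P\<^esub> f x = k \<odot>\<^bsub>P\<^esub> (v x \<odot>\<^bsub>P\<^esub> f x)"
        using free_space_coeff(3)[OF v] f k by (auto simp: free_space_simps P.smult_assoc1 Pi_iff)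
    qed (use T(1) summand[OF v] k in auto)
    also have "\<dots> = k \<odot>\<^bsub>P\<^esub> linear_extension R P f v"
      unfolding linear_extension_def
      by (rule P.finsum_smult_ldistr[symmetric]) (use T summand[OF v] k in auto)
    finally show "linear_extension R P f (k \<odot>\<^bsub>free_space R S\<^esub> v) = k \<odot>\<^bsub>P\<^esub> linear_extension R P f v" .
  qed
qed

end

section \<open>Quotient modules\<close>

context
  fixes R :: "('k, 'r) ring_scheme" and M :: "('k, 'a) module" and W :: "'a set"
  assumes M: "module R M" and W: "submodule W R M"
begin

interpretation M: module R M by (rule M)

interpretation W: abelian_subgroup W M
  by (rule abelian_subgroupI3[OF additive_subgroupI[OF submodule.axioms(1)[OF W]] M.M.abelian_group_axioms])

lemma quotient_carrier: "carrier (quotient_space M W) = (\<lambda>v. W +>\<^bsub>M\<^esub> v) ` carrier M"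
  by (auto simp: quotient_space_def A_RCOSETS_defs a_r_coset_def r_coset_def)

lemma quotient_add:
  assumes "v \<in> carrier M" and "w \<in> carrier M"
  shows "(W +>\<^bsub>M\<^esub> v) \<oplus>\<^bsub>quotient_space M W\<^esub> (W +>\<^bsub>M\<^esub> w) = W +>\<^bsub>M\<^esub> (v \<oplus>\<^bsub>M\<^esub> w)"
  using assms by (simp add: quotient_space_def W.a_rcos_sum)

lemma coset_eq_iff:
  assumes "v \<in> carrier M" and "w \<in> carrier M"
  shows "W +>\<^bsub>M\<^esub> v = W +>\<^bsub>M\<^esub> w \<longleftrightarrow> v \<ominus>\<^bsub>M\<^esub> w \<in> W"
proof -
  have "v \<ominus>\<^bsub>M\<^esub> w \<in> W \<longleftrightarrow> v \<in> W +>\<^bsub>M\<^esub> w"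
    using assms by (simp add: W.a_rcos_module M.M.minus_eq)
  then show ?thesis
    using W.a_repr_independence'[OF _ assms(2), of v] W.a_rcos_self[OF assms(1)] by auto
qed

text \<open>The scalar action is encoded as a union over all representatives. Two representatives
  differ by some \<open>h\<close> in \<open>W\<close>, and \<open>k\<close> times \<open>h\<close>
  is again in \<open>W\<close>, so every member of the union is the same coset; the union is
  nonempty since \<open>v\<close> lies in its own coset.\<close>

lemma quotient_smult:
  assumes k: "k \<in> carrier R" and v: "v \<in> carrier M"
  shows "k \<odot>\<^bsub>quotient_space M W\<^esub> (W +>\<^bsub>M\<^esub> v) = W +>\<^bsub>M\<^esub> (k \<odot>\<^bsub>M\<^esub> v)"
proof -
  have "W +>\<^bsub>M\<^esub> (k \<odot>\<^bsub>M\<^esub> w) = W +>\<^bsub>M\<^esub> (k \<odot>\<^bsub>M\<^esub> v)" if "w \<in> W +>\<^bsub>M\<^esub> v" for w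
  proof -
    from that obtain h where h: "h \<in> W" "w = h \<oplus>\<^bsub>M\<^esub> v"
      by (auto simp: a_r_coset_def r_coset_def)
    have hM: "h \<in> carrier M" using h(1) W.a_subset by blast
    have "k \<odot>\<^bsub>M\<^esub> w \<ominus>\<^bsub>M\<^esub> k \<odot>\<^bsub>M\<^esub> v = k \<odot>\<^bsub>M\<^esub> h"
      using k v hM by (simp add: h(2) M.smult_r_distr M.M.minus_eq M.M.a_assoc M.M.r_neg)
    moreover have "k \<odot>\<^bsub>M\<^esub> h \<in> W"
      by (rule submodule.smult_closed[OF W k h(1)])
    ultimately show ?thesis
      using h(2) hM k v by (simp add: coset_eq_iff)
  qed
  then have "(\<Union>w \<in> W +>\<^bsub>M\<^esub> v. W +>\<^bsub>M\<^esub> (k \<odot>\<^bsub>M\<^esub> w)) = (\<Union>w \<in> W +>\<^bsub>M\<^esub> v. W +>\<^bsub>M\<^esub> (k \<odot>\<^bsub>M\<^esub> v))"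
    by (rule SUP_cong[OF refl])
  also have "\<dots> = W +>\<^bsub>M\<^esub> (k \<odot>\<^bsub>M\<^esub> v)"
    using W.a_rcos_self[OF v] by blast
  finally show ?thesis
    by (simp add: quotient_space_def)
qed

lemma quotient_zero: "\<zero>\<^bsub>quotient_space M W\<^esub> = W +>\<^bsub>M\<^esub> \<zero>\<^bsub>M\<^esub>"
  using W.a_subset by (simp add: quotient_space_def M.M.a_coset_add_zero)

lemma quotient_space_module: "module R (quotient_space M W)"
proof (rule moduleI)
  note q = quotient_carrier quotient_add quotient_smult quotient_zero
  show "abelian_group (quotient_space M W)"
  proof (rule abelian_groupI)
    fix T assume "T \<in> carrier (quotient_space M W)"
    then obtain v where v: "v \<in> carrier M" "T = W +>\<^bsub>M\<^esub> v" by (auto simp: q)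
    then have "(W +>\<^bsub>M\<^esub> \<ominus>\<^bsub>M\<^esub> v) \<oplus>\<^bsub>quotient_space M W\<^esub> T = \<zero>\<^bsub>quotient_space M W\<^esub>"
      by (simp add: q M.M.l_neg)
    then show "\<exists>S \<in> carrier (quotient_space M W). S \<oplus>\<^bsub>quotient_space M W\<^esub> T = \<zero>\<^bsub>quotient_space M W\<^esub>"
      using v by (auto simp: q(1))
  qed (auto simp: q M.M.a_ac)
qed (auto simp: quotient_carrier quotient_add quotient_smult M.smult_l_distr M.smult_r_distr
    M.smult_assoc1 M.R.is_cring)

lemma quotient_projection_linear: "linear_map R M (quotient_space M W) (\<lambda>v. W +>\<^bsub>M\<^esub> v)"
  by (rule linear_mapI) (auto simp: quotient_carrier quotient_add quotient_smult)

end

section \<open>The universal property of the tensor product\<close>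

definition bilinear ::
  "('k, 'r) ring_scheme \<Rightarrow> ('k, 'a, 'm) module_scheme \<Rightarrow> ('k, 'b, 'n) module_scheme
    \<Rightarrow> ('k, 'c, 'p) module_scheme \<Rightarrow> ('a \<Rightarrow> 'b \<Rightarrow> 'c) \<Rightarrow> bool"
  where "bilinear R M N P f \<longleftrightarrow>
    (\<forall>n \<in> carrier N. linear_map R M P (\<lambda>m. f m n)) \<and> (\<forall>m \<in> carrier M. linear_map R N P (f m))"

lemma bilinearI:
  assumes "\<And>n. n \<in> carrier N \<Longrightarrow> linear_map R M P (\<lambda>m. f m n)"
    and "\<And>m. m \<in> carrier M \<Longrightarrow> linear_map R N P (\<lambda>n. f m n)"
  shows "bilinear R M N P f"
  using assms by (simp add: bilinear_def)

lemma bilinearD: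
  assumes "bilinear R M N P f"
  shows "n \<in> carrier N \<Longrightarrow> linear_map R M P (\<lambda>m. f m n)"
    and "m \<in> carrier M \<Longrightarrow> linear_map R N P (\<lambda>n. f m n)"
  using assms by (simp_all add: bilinear_def)

lemma bilinear_comp:
  assumes "bilinear R M N P f" and "linear_map R M' M g" and "linear_map R N' N h"
  shows "bilinear R M' N' P (\<lambda>x y. f (g x) (h y))"
proof (rule bilinearI)
  fix y assume "y \<in> carrier N'"
  then show "linear_map R M' P (\<lambda>x. f (g x) (h y))"
    by (intro linear_map_comp[of R M P "\<lambda>m. f m (h y)" M' g] bilinearD(1)[OF assms(1)]
        linear_mapD(1)[OF assms(3)] assms(2))
next
  fix x assume "x \<in> carrier M'"
  then show "linear_map R N' P (\<lambda>y. f (g x) (h y))"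
    by (intro linear_map_comp[of R N P "f (g x)" N' h] bilinearD(2)[OF assms(1)]
        linear_mapD(1)[OF assms(2)] assms(3))
qed

lemma linear_comp_bilinear:
  assumes "linear_map R P Q h" and "bilinear R M N P f"
  shows "bilinear R M N Q (\<lambda>x y. h (f x y))"
  by (intro bilinearI linear_map_comp[OF assms(1)] bilinearD[OF assms(2)])

context
  fixes R :: "('k, 'r) ring_scheme" and M :: "('k, 'a, 'm) module_scheme"
    and N :: "('k, 'b, 'n) module_scheme"
  assumes M: "module R M" and N: "module R N"
begin

interpretation M: module R M by (rule M)
interpretation N: module R N by (rule N)

private abbreviation (input) "F \<equiv> pair_space R M N"
private abbreviation (input) "W \<equiv> bilinear_subspace R M N"
private abbreviation (input) "e m n \<equiv> free_basis R (m, n)"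

lemma pair_space_module: "module R F"
  unfolding pair_space_def by (rule free_space_module[OF M.R.is_cring])

interpretation F: module R F by (rule pair_space_module)

private lemma basis_closed: "m \<in> carrier M \<Longrightarrow> n \<in> carrier N \<Longrightarrow> e m n \<in> carrier F"
  unfolding pair_space_def by (rule free_basis_closed[OF M.R.is_cring]) simp

lemma bilinear_relsI:
  "m \<in> carrier M \<Longrightarrow> m' \<in> carrier M \<Longrightarrow> n \<in> carrier N \<Longrightarrow>
    e (m \<oplus>\<^bsub>M\<^esub> m') n \<ominus>\<^bsub>F\<^esub> (e m n \<oplus>\<^bsub>F\<^esub> e m' n) \<in> bilinear_rels R M N"
  "m \<in> carrier M \<Longrightarrow> n \<in> carrier N \<Longrightarrow> n' \<in> carrier N \<Longrightarrow>
    e m (n \<oplus>\<^bsub>N\<^esub> n') \<ominus>\<^bsub>F\<^esub> (e m n \<oplus>\<^bsub>F\<^esub> e m n') \<in> bilinear_rels R M N"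
  "k \<in> carrier R \<Longrightarrow> m \<in> carrier M \<Longrightarrow> n \<in> carrier N \<Longrightarrow>
    e (k \<odot>\<^bsub>M\<^esub> m) n \<ominus>\<^bsub>F\<^esub> k \<odot>\<^bsub>F\<^esub> e m n \<in> bilinear_rels R M N"
  "k \<in> carrier R \<Longrightarrow> m \<in> carrier M \<Longrightarrow> n \<in> carrier N \<Longrightarrow>
    e m (k \<odot>\<^bsub>N\<^esub> n) \<ominus>\<^bsub>F\<^esub> k \<odot>\<^bsub>F\<^esub> e m n \<in> bilinear_rels R M N"
  unfolding bilinear_rels_def Let_def
  subgoal by (rule UnI1, rule UnI1, rule UnI1, rule CollectI, intro exI conjI, rule refl)
  subgoal by (rule UnI1, rule UnI1, rule UnI2, rule CollectI, intro exI conjI, rule refl)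
  subgoal by (rule UnI1, rule UnI2, rule CollectI, intro exI conjI, rule refl)
  subgoal by (rule UnI2, rule CollectI, intro exI conjI, rule refl)
  done

lemma bilinear_relsE:
  assumes "r \<in> bilinear_rels R M N"
  obtains (add_left) m m' n where "m \<in> carrier M" "m' \<in> carrier M" "n \<in> carrier N"
      "r = e (m \<oplus>\<^bsub>M\<^esub> m') n \<ominus>\<^bsub>F\<^esub> (e m n \<oplus>\<^bsub>F\<^esub> e m' n)"
    | (add_right) m n n' where "m \<in> carrier M" "n \<in> carrier N" "n' \<in> carrier N"
      "r = e m (n \<oplus>\<^bsub>N\<^esub> n') \<ominus>\<^bsub>F\<^esub> (e m n \<oplus>\<^bsub>F\<^esub> e m n')"
    | (smult_left) k m n where "k \<in> carrier R" "m \<in> carrier M" "n \<in> carrier N"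
      "r = e (k \<odot>\<^bsub>M\<^esub> m) n \<ominus>\<^bsub>F\<^esub> k \<odot>\<^bsub>F\<^esub> e m n"
    | (smult_right) k m n where "k \<in> carrier R" "m \<in> carrier M" "n \<in> carrier N"
      "r = e m (k \<odot>\<^bsub>N\<^esub> n) \<ominus>\<^bsub>F\<^esub> k \<odot>\<^bsub>F\<^esub> e m n"
  using assms unfolding bilinear_rels_def Let_def
  apply (elim UnE CollectE exE conjE)
  subgoal by (rule that(1))
  subgoal by (rule that(2))
  subgoal by (rule that(3))
  subgoal by (rule that(4))
  done

lemma bilinear_rels_subset: "bilinear_rels R M N \<subseteq> carrier F"
proof
  fix r assume "r \<in> bilinear_rels R M N"
  then show "r \<in> carrier F"
    by (cases rule: bilinear_relsE) (simp_all add: basis_closed)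
qed

lemma bilinear_subspace_submodule: "submodule W R F"
  unfolding bilinear_subspace_def
  by (rule submodule_generated_submodule[OF pair_space_module bilinear_rels_subset])

lemma bilinear_rels_in_subspace: "r \<in> bilinear_rels R M N \<Longrightarrow> r \<in> W"
  unfolding bilinear_subspace_def by (rule subsetD[OF submodule_generated_incl])

lemma tensor_module: "module R (tensor R M N)"
  unfolding tensor_def by (rule quotient_space_module[OF pair_space_module bilinear_subspace_submodule])

lemma tensor_carrier: "carrier (tensor R M N) = (\<lambda>v. W +>\<^bsub>F\<^esub> v) ` carrier F"
  unfolding tensor_def by (rule quotient_carrier[OF pair_space_module bilinear_subspace_submodule])

lemma tensor_projection_linear: "linear_map R F (tensor R M N) (\<lambda>v. W +>\<^bsub>F\<^esub> v)"
  unfolding tensor_def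
  by (rule quotient_projection_linear[OF pair_space_module bilinear_subspace_submodule])

text \<open>Each of the four families of relations is a difference of two vectors that lies in the
  subspace factored out. The corresponding cosets therefore coincide, and linearity of the
  projection splits the right-hand coset.\<close>

lemma bilinear_pure: "bilinear R M N (tensor R M N) (pure R M N)"
proof -
  note proj = linear_mapD[OF tensor_projection_linear]
  have eq: "W +>\<^bsub>F\<^esub> v = W +>\<^bsub>F\<^esub> w"
    if "v \<ominus>\<^bsub>F\<^esub> w \<in> bilinear_rels R M N" "v \<in> carrier F" "w \<in> carrier F" for v w
    using coset_eq_iff[OF pair_space_module bilinear_subspace_submodule that(2,3)]
      bilinear_rels_in_subspace[OF that(1)] by simp
  note basis = basis_closed F.M.a_closed F.smult_closed M.M.a_closed N.M.a_closed M.smult_closed N.smult_closed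
  show ?thesis
  proof (intro bilinearI linear_mapI; unfold pure_def)
    fix m m' n assume "m \<in> carrier M" "m' \<in> carrier M" "n \<in> carrier N"
    then show "W +>\<^bsub>F\<^esub> e (m \<oplus>\<^bsub>M\<^esub> m') n = (W +>\<^bsub>F\<^esub> e m n) \<oplus>\<^bsub>tensor R M N\<^esub> (W +>\<^bsub>F\<^esub> e m' n)"
      by (intro trans[OF eq[OF bilinear_relsI(1)] proj(2)] basis)
  next
    fix m n n' assume "m \<in> carrier M" "n \<in> carrier N" "n' \<in> carrier N"
    then show "W +>\<^bsub>F\<^esub> e m (n \<oplus>\<^bsub>N\<^esub> n') = (W +>\<^bsub>F\<^esub> e m n) \<oplus>\<^bsub>tensor R M N\<^esub> (W +>\<^bsub>F\<^esub> e m n')"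
      by (intro trans[OF eq[OF bilinear_relsI(2)] proj(2)] basis)
  next
    fix k m n assume "k \<in> carrier R" "m \<in> carrier M" "n \<in> carrier N"
    note kmn = this
    show "W +>\<^bsub>F\<^esub> e (k \<odot>\<^bsub>M\<^esub> m) n = k \<odot>\<^bsub>tensor R M N\<^esub> (W +>\<^bsub>F\<^esub> e m n)"
      by (intro trans[OF eq[OF bilinear_relsI(3)] proj(3)] basis kmn)
    show "W +>\<^bsub>F\<^esub> e m (k \<odot>\<^bsub>N\<^esub> n) = k \<odot>\<^bsub>tensor R M N\<^esub> (W +>\<^bsub>F\<^esub> e m n)"
      by (intro trans[OF eq[OF bilinear_relsI(4)] proj(3)] basis kmn)
  qed (simp_all add: proj(1) basis_closed)
qed

lemma pure_closed: "m \<in> carrier M \<Longrightarrow> n \<in> carrier N \<Longrightarrow> pure R M N m n \<in> carrier (tensor R M N)"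
  by (rule linear_mapD(1)[OF bilinearD(2)[OF bilinear_pure]])

text \<open>This is the uniqueness half of the universal property. Pulled back along the projection,
  the two maps have an equalizer in the free module that contains all basis vectors and hence
  everything.\<close>

lemma tensor_ext:
  assumes P: "module R P" and f: "linear_map R (tensor R M N) P f" and g: "linear_map R (tensor R M N) P g"
    and pures: "\<And>m n. m \<in> carrier M \<Longrightarrow> n \<in> carrier N \<Longrightarrow> f (pure R M N m n) = g (pure R M N m n)"
    and t: "t \<in> carrier (tensor R M N)"
  shows "f t = g t"
proof -
  let ?E = "{v \<in> carrier F. f (W +>\<^bsub>F\<^esub> v) = g (W +>\<^bsub>F\<^esub> v)}"
  have sub: "submodule ?E R F"
    by (intro submodule_equalizer[OF pair_space_module P] linear_map_comp[OF _ tensor_projection_linear] f g)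
  have "?E = carrier F"
  proof (rule free_space_eq_basis_span[of R _ "carrier M \<times> carrier N", folded pair_space_def,
        OF M.R.is_cring sub])
    fix s assume "s \<in> carrier M \<times> carrier N"
    then show "free_basis R s \<in> ?E"
      using pures by (auto simp: basis_closed pure_def)
  qed
  moreover obtain v where v: "v \<in> carrier F" "t = W +>\<^bsub>F\<^esub> v"
    using t by (auto simp: tensor_carrier)
  ultimately have "v \<in> ?E" by (simp only:)
  then show ?thesis
    by (simp add: v(2))
qed

section \<open>Existence of the linear map induced by a bilinear map\<close>

context
  fixes P :: "('k, 'c, 'p) module_scheme" and f :: "'a \<Rightarrow> 'b \<Rightarrow> 'c"
  assumes P: "module R P" and f: "bilinear R M N P f"
begin

interpretation P: module R P by (rule P)

private abbreviation (input) "ext \<equiv> linear_extension R P (\<lambda>x. f (fst x) (snd x))"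

private lemma ext_linear: "linear_map R F P ext"
  unfolding pair_space_def
  by (rule linear_extension_linear[OF P]) (auto intro: linear_mapD(1)[OF bilinearD(2)[OF f]])

private lemma ext_basis: "m \<in> carrier M \<Longrightarrow> n \<in> carrier N \<Longrightarrow> ext (e m n) = f m n"
  by (subst linear_extension_basis[OF P, of _ "carrier M \<times> carrier N"])
    (auto intro: linear_mapD(1)[OF bilinearD(2)[OF f]])

text \<open>Bilinearity of \<open>f\<close> puts each of the four kinds of relation into the kernel
  of the linear extension. The kernel is a submodule, so it contains the whole subspace they
  generate.\<close>

private lemma ext_subspace:
  assumes "w \<in> W"
  shows "ext w = \<zero>\<^bsub>P\<^esub>"
proof -
  have "linear_map R F P (\<lambda>_. \<zero>\<^bsub>P\<^esub>)"
    by (rule linear_mapI) simp_all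
  then have sub: "submodule {v \<in> carrier F. ext v = \<zero>\<^bsub>P\<^esub>} R F"
    by (rule submodule_equalizer[OF pair_space_module P ext_linear])
  have "bilinear_rels R M N \<subseteq> {v \<in> carrier F. ext v = \<zero>\<^bsub>P\<^esub>}"
  proof
    fix r assume r: "r \<in> bilinear_rels R M N"
    note fl = linear_mapD[OF bilinearD(1)[OF f]] linear_mapD[OF bilinearD(2)[OF f]]
    have "ext r = \<zero>\<^bsub>P\<^esub>"
      using r
      by (cases rule: bilinear_relsE)
        (simp_all add: linear_map_minus[OF pair_space_module P ext_linear] basis_closed ext_basis
          linear_mapD[OF ext_linear] fl P.M.minus_eq P.M.r_neg)
    then show "r \<in> {v \<in> carrier F. ext v = \<zero>\<^bsub>P\<^esub>}"
      using subsetD[OF bilinear_rels_subset r] by simp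
  qed
  then have "W \<subseteq> {v \<in> carrier F. ext v = \<zero>\<^bsub>P\<^esub>}"
    unfolding bilinear_subspace_def by (rule submodule_generated_least[OF sub])
  from subsetD[OF this assms] show ?thesis
    by simp
qed

text \<open>The representative picked by \<open>SOME\<close> differs from \<open>v\<close> by an
  element of the subspace, on which the extension vanishes. So the choice is immaterial, and the sum
  in \<open>tensor_lift\<close> is the linear extension evaluated at \<open>v\<close>.\<close>

private lemma tensor_lift_coset:
  assumes v: "v \<in> carrier F"
  shows "tensor_lift R P f (W +>\<^bsub>F\<^esub> v) = ext v"
proof -
  interpret W: abelian_subgroup W F
    by (rule abelian_subgroupI3[OF additive_subgroupI[OF submodule.axioms(1)[OF bilinear_subspace_submodule]]
          F.M.abelian_group_axioms])
  define u where "u = (SOME u. u \<in> W +>\<^bsub>F\<^esub> v)"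
  have u: "u \<in> W +>\<^bsub>F\<^esub> v"
    unfolding u_def by (rule someI[where P = "\<lambda>u. u \<in> W +>\<^bsub>F\<^esub> v", OF W.a_rcos_self[OF v]])
  then obtain w where w: "w \<in> W" "u = w \<oplus>\<^bsub>F\<^esub> v"
    by (auto simp: a_r_coset_def r_coset_def)
  have "w \<in> carrier F" using w(1) W.a_subset by blast
  then have "ext u = ext v"
    using w(1) v linear_mapD(1)[OF ext_linear v]
    by (simp add: w(2) linear_mapD(2)[OF ext_linear] ext_subspace)
  then show ?thesis
    by (simp add: tensor_lift_def u_def linear_extension_def)
qed

lemma tensor_lift_linear: "linear_map R (tensor R M N) P (tensor_lift R P f)"
proof (rule linear_mapI)
  \<comment> \<open>Reversed, linearity of the projection gathers a sum of cosets into the coset of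
    a sum, to which \<open>tensor_lift_coset\<close> applies.\<close>
  note proj = linear_mapD(2,3)[OF tensor_projection_linear, symmetric]
  fix s t assume "s \<in> carrier (tensor R M N)" "t \<in> carrier (tensor R M N)"
  then show "tensor_lift R P f (s \<oplus>\<^bsub>tensor R M N\<^esub> t) = tensor_lift R P f s \<oplus>\<^bsub>P\<^esub> tensor_lift R P f t"
    by (auto simp: tensor_carrier proj tensor_lift_coset linear_mapD(2)[OF ext_linear])
next
  note proj = linear_mapD(2,3)[OF tensor_projection_linear, symmetric]
  fix k t assume "k \<in> carrier R" "t \<in> carrier (tensor R M N)"
  then show "tensor_lift R P f (k \<odot>\<^bsub>tensor R M N\<^esub> t) = k \<odot>\<^bsub>P\<^esub> tensor_lift R P f t"
    by (auto simp: tensor_carrier proj tensor_lift_coset linear_mapD(3)[OF ext_linear])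
qed (auto simp: tensor_carrier tensor_lift_coset linear_mapD(1)[OF ext_linear])

lemma tensor_lift_pure:
  "m \<in> carrier M \<Longrightarrow> n \<in> carrier N \<Longrightarrow> tensor_lift R P f (pure R M N m n) = f m n"
  by (simp add: pure_def tensor_lift_coset basis_closed ext_basis)

end

end

text \<open>Maps are total HOL functions, so a map known to be linear may be replaced by one that
  differs from it off the carrier.\<close>

lemma linear_map_cong:
  assumes "module R M" and f: "linear_map R M N f" and h: "\<And>x. x \<in> carrier M \<Longrightarrow> f x = h x"
  shows "linear_map R M N h"
proof -
  interpret M: module R M by fact
  show ?thesis
    by (rule linear_mapI) (simp_all add: h[symmetric] linear_mapD[OF f])
qed

lemma linear_map_add:
  assumes "module R N" and f: "linear_map R M N f" and g: "linear_map R M N g"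
  shows "linear_map R M N (\<lambda>x. f x \<oplus>\<^bsub>N\<^esub> g x)"
proof -
  interpret N: module R N by fact
  show ?thesis
    by (rule linear_mapI)
      (simp_all add: linear_mapD[OF f] linear_mapD[OF g] N.smult_r_distr N.M.a_ac)
qed

text \<open>Commutativity of the scalars lets \<open>k\<close> pass the scalar in the homogeneity
  condition.\<close>

lemma linear_map_smult:
  assumes "module R N" and k: "k \<in> carrier R" and f: "linear_map R M N f"
  shows "linear_map R M N (\<lambda>x. k \<odot>\<^bsub>N\<^esub> f x)"
proof -
  interpret N: module R N by fact
  show ?thesis
    by (rule linear_mapI)
      (simp_all add: linear_mapD[OF f] k N.smult_r_distr N.smult_assoc1[symmetric] N.R.m_comm)
qed

text \<open>For fixed parameters both sides of each linearity equation are linear in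
  \<open>t\<close> and agree on pure tensors, where the lift is just \<open>f z x y\<close>. This is
  what makes iterated lifts bilinear: in the associator and in the componentwise product the inner
  lift depends on the outer variables.\<close>

lemma tensor_lift_linear_parameter:
  assumes L: "module R L" and M: "module R M" and N: "module R N" and P: "module R P"
    and bil: "\<And>z. z \<in> carrier N \<Longrightarrow> bilinear R L M P (f z)"
    and lin: "\<And>x y. x \<in> carrier L \<Longrightarrow> y \<in> carrier M \<Longrightarrow> linear_map R N P (\<lambda>z. f z x y)"
    and t: "t \<in> carrier (tensor R L M)"
  shows "linear_map R N P (\<lambda>z. tensor_lift R P (f z) t)"
proof -
  interpret N: module R N by fact
  note lift = tensor_lift_linear[OF L M P bil] and lift_pure = tensor_lift_pure[OF L M P bil]
  show ?thesis
  proof (rule linear_mapI)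
    fix z assume "z \<in> carrier N"
    then show "tensor_lift R P (f z) t \<in> carrier P"
      by (rule linear_mapD(1)[OF lift t])
  next
    fix z z' assume z: "z \<in> carrier N" "z' \<in> carrier N"
    show "tensor_lift R P (f (z \<oplus>\<^bsub>N\<^esub> z')) t = tensor_lift R P (f z) t \<oplus>\<^bsub>P\<^esub> tensor_lift R P (f z') t"
    proof (rule tensor_ext[OF L M P _ _ _ t])
      show "linear_map R (tensor R L M) P (tensor_lift R P (f (z \<oplus>\<^bsub>N\<^esub> z')))"
        using z by (intro lift N.M.a_closed)
      show "linear_map R (tensor R L M) P (\<lambda>t. tensor_lift R P (f z) t \<oplus>\<^bsub>P\<^esub> tensor_lift R P (f z') t)"
        by (intro linear_map_add[OF P] lift z)
    qed (simp add: lift_pure z linear_mapD(2)[OF lin])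
  next
    fix k z assume z: "k \<in> carrier R" "z \<in> carrier N"
    show "tensor_lift R P (f (k \<odot>\<^bsub>N\<^esub> z)) t = k \<odot>\<^bsub>P\<^esub> tensor_lift R P (f z) t"
    proof (rule tensor_ext[OF L M P _ _ _ t])
      show "linear_map R (tensor R L M) P (tensor_lift R P (f (k \<odot>\<^bsub>N\<^esub> z)))"
        using z by (intro lift N.smult_closed)
      show "linear_map R (tensor R L M) P (\<lambda>t. k \<odot>\<^bsub>P\<^esub> tensor_lift R P (f z) t)"
        by (intro linear_map_smult[OF P] lift z)
    qed (simp add: lift_pure z linear_mapD(3)[OF lin])
  qed
qed

text \<open>Extensionality is applied first in \<open>s\<close> with \<open>t\<close> arbitrary and
  then in \<open>t\<close> with \<open>s\<close> pure. Identities about the componentwise product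
  are checked this way.\<close>

lemma bilinear_tensor_ext:
  assumes "module R L" "module R M" "module R L'" "module R M'" "module R P"
    and f: "bilinear R (tensor R L M) (tensor R L' M') P f"
    and g: "bilinear R (tensor R L M) (tensor R L' M') P g"
    and pures: "\<And>x y x' y'. \<lbrakk>x \<in> carrier L; y \<in> carrier M; x' \<in> carrier L'; y' \<in> carrier M'\<rbrakk> \<Longrightarrow>
      f (pure R L M x y) (pure R L' M' x' y') = g (pure R L M x y) (pure R L' M' x' y')"
    and s: "s \<in> carrier (tensor R L M)" and t: "t \<in> carrier (tensor R L' M')"
  shows "f s t = g s t"
proof (rule tensor_ext[OF assms(1,2,5) bilinearD(1)[OF f t] bilinearD(1)[OF g t] _ s])
  fix x y assume xy: "x \<in> carrier L" "y \<in> carrier M"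
  note p = pure_closed[OF assms(1,2) xy]
  show "f (pure R L M x y) t = g (pure R L M x y) t"
    by (rule tensor_ext[OF assms(3,4,5) bilinearD(2)[OF f p] bilinearD(2)[OF g p] pures[OF xy] t])
qed

section \<open>Functoriality of the tensor product\<close>

lemma bilinear_pure_comp:
  assumes "module R M" "module R N" and "linear_map R M' M f" and "linear_map R N' N g"
  shows "bilinear R M' N' (tensor R M N) (\<lambda>x y. pure R M N (f x) (g y))"
  by (rule bilinear_comp[OF bilinear_pure[OF assms(1,2)] assms(3,4)])

context
  fixes R :: "('k, 'r) ring_scheme" and M :: "('k, 'a, 'm) module_scheme" and N :: "('k, 'b, 'n) module_scheme"
    and M' :: "('k, 'c, 'p) module_scheme" and N' :: "('k, 'd, 'q) module_scheme" and f g
  assumes modules: "module R M" "module R N" "module R M'" "module R N'"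
    and f: "linear_map R M M' f" and g: "linear_map R N N' g"
begin

lemma tensor_map_linear: "linear_map R (tensor R M N) (tensor R M' N') (tensor_map R M' N' f g)"
  unfolding tensor_map_def
  by (intro tensor_lift_linear tensor_module bilinear_pure_comp modules f g)

lemma tensor_map_pure:
  "x \<in> carrier M \<Longrightarrow> y \<in> carrier N \<Longrightarrow>
    tensor_map R M' N' f g (pure R M N x y) = pure R M' N' (f x) (g y)"
  unfolding tensor_map_def
  by (rule tensor_lift_pure[OF modules(1,2) tensor_module[OF modules(3,4)] bilinear_pure_comp[OF modules(3,4) f g]])

end

lemma tensor_map_closed:
  assumes "module R M" "module R N" "module R M'" "module R N'"
    and "linear_map R M M' f" and "linear_map R N N' g" and "t \<in> carrier (tensor R M N)"
  shows "tensor_map R M' N' f g t \<in> carrier (tensor R M' N')"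
  by (rule linear_mapD(1)[OF tensor_map_linear[OF assms(1-6)] assms(7)])

text \<open>Both sides agree on pure tensors. The composites are named \<open>h\<close> and
  \<open>k\<close> and need agree with the actual composites only on the carriers, so one
  application can fuse two maps and use a commutation rule or comultiplicativity at once. Read
  backwards, the same rule splits a map.\<close>

lemma tensor_map_comp:
  assumes M: "module R M" "module R N" and M': "module R M'" "module R N'"
    and M'': "module R M''" "module R N''"
    and f: "linear_map R M M' f" and g: "linear_map R N N' g"
    and f': "linear_map R M' M'' f'" and g': "linear_map R N' N'' g'"
    and h: "\<And>x. x \<in> carrier M \<Longrightarrow> f' (f x) = h x" and k: "\<And>y. y \<in> carrier N \<Longrightarrow> g' (g y) = k y"
    and t: "t \<in> carrier (tensor R M N)"
  shows "tensor_map R M'' N'' f' g' (tensor_map R M' N' f g t) = tensor_map R M'' N'' h k t"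
proof (rule tensor_ext[OF M tensor_module[OF M''] _ _ _ t])
  \<comment> \<open>Linearity of \<open>h\<close> and \<open>k\<close> is inherited from the
    composites, with which they agree on the carriers.\<close>
  have hlin: "linear_map R M M'' h" and klin: "linear_map R N N'' k"
    by (rule linear_map_cong[OF M(1) linear_map_comp[OF f' f] h] linear_map_cong[OF M(2) linear_map_comp[OF g' g] k];
        assumption)+
  show "linear_map R (tensor R M N) (tensor R M'' N'') (tensor_map R M'' N'' h k)"
    by (rule tensor_map_linear[OF M M'' hlin klin])
  show "linear_map R (tensor R M N) (tensor R M'' N'')
      (\<lambda>t. tensor_map R M'' N'' f' g' (tensor_map R M' N' f g t))"
    by (rule linear_map_comp[OF tensor_map_linear[OF M' M'' f' g'] tensor_map_linear[OF M M' f g]])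
  fix x y assume xy: "x \<in> carrier M" "y \<in> carrier N"
  show "tensor_map R M'' N'' f' g' (tensor_map R M' N' f g (pure R M N x y))
      = tensor_map R M'' N'' h k (pure R M N x y)"
    using xy by (simp add: tensor_map_pure[OF M M' f g] tensor_map_pure[OF M' M'' f' g']
        tensor_map_pure[OF M M'' hlin klin] linear_mapD(1)[OF f] linear_mapD(1)[OF g] h k)
qed

section \<open>Associators and unitors\<close>

context
  fixes R :: "('k, 'r) ring_scheme" and L :: "('k, 'a, 'l) module_scheme"
    and M :: "('k, 'b, 'm) module_scheme" and N :: "('k, 'c, 'n) module_scheme"
  assumes L: "module R L" and M: "module R M" and N: "module R N"
begin

private abbreviation (input) "MN \<equiv> tensor R M N"
private abbreviation (input) "P \<equiv> tensor R L MN"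

private lemma MN: "module R MN" and P: "module R P"
  by (intro tensor_module L M N)+

private lemma assoc_inner_bilinear:
  assumes "z \<in> carrier N"
  shows "bilinear R L M P (\<lambda>x y. pure R L MN x (pure R M N y z))"
  by (rule bilinear_comp[OF bilinear_pure[OF L MN] linear_map_id[unfolded id_def]
        bilinearD(1)[OF bilinear_pure[OF M N] assms]])

text \<open>In \<open>t\<close> the map is a lift, hence linear; in \<open>z\<close> it is a lift
  whose prescription depends linearly on a parameter.\<close>

private lemma assoc_outer_bilinear:
  "bilinear R (tensor R L M) N P (\<lambda>t z. tensor_lift R P (\<lambda>x y. pure R L MN x (pure R M N y z)) t)"
proof (rule bilinearI)
  fix z assume "z \<in> carrier N"
  then show "linear_map R (tensor R L M) P (tensor_lift R P (\<lambda>x y. pure R L MN x (pure R M N y z)))"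
    by (rule tensor_lift_linear[OF L M P assoc_inner_bilinear])
next
  fix t assume t: "t \<in> carrier (tensor R L M)"
  show "linear_map R N P (\<lambda>z. tensor_lift R P (\<lambda>x y. pure R L MN x (pure R M N y z)) t)"
  proof (rule tensor_lift_linear_parameter[OF L M N P assoc_inner_bilinear _ t])
    fix x y assume "x \<in> carrier L" "y \<in> carrier M"
    then show "linear_map R N P (\<lambda>z. pure R L MN x (pure R M N y z))"
      by (intro linear_map_comp[OF bilinearD(2)[OF bilinear_pure[OF L MN]] bilinearD(2)[OF bilinear_pure[OF M N]]])
  qed
qed

lemma tensor_assoc_linear:
  "linear_map R (tensor R (tensor R L M) N) (tensor R L (tensor R M N)) (tensor_assoc R L M N)"
  unfolding tensor_assoc_def Let_def
  by (rule tensor_lift_linear[OF tensor_module[OF L M] N P assoc_outer_bilinear])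

lemma tensor_assoc_pure:
  assumes "x \<in> carrier L" "y \<in> carrier M" "z \<in> carrier N"
  shows "tensor_assoc R L M N (pure R (tensor R L M) N (pure R L M x y) z)
    = pure R L (tensor R M N) x (pure R M N y z)"
  unfolding tensor_assoc_def Let_def
  by (subst tensor_lift_pure[OF tensor_module[OF L M] N P assoc_outer_bilinear])
    (simp_all add: assms pure_closed[OF L M] tensor_lift_pure[OF L M P assoc_inner_bilinear])

text \<open>For fixed \<open>z\<close> the tensor of \<open>s\<close> with \<open>z\<close> is
  linear in \<open>s\<close>, so a second use of extensionality reduces \<open>s\<close> to a pure
  tensor.\<close>

lemma tensor_ext_left_nested:
  assumes Q: "module R Q" and f: "linear_map R (tensor R (tensor R L M) N) Q f"
    and g: "linear_map R (tensor R (tensor R L M) N) Q g"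
    and pures: "\<And>x y z. \<lbrakk>x \<in> carrier L; y \<in> carrier M; z \<in> carrier N\<rbrakk> \<Longrightarrow>
      f (pure R (tensor R L M) N (pure R L M x y) z) = g (pure R (tensor R L M) N (pure R L M x y) z)"
    and t: "t \<in> carrier (tensor R (tensor R L M) N)"
  shows "f t = g t"
proof (rule tensor_ext[OF tensor_module[OF L M] N Q f g _ t])
  fix s z assume s: "s \<in> carrier (tensor R L M)" and z: "z \<in> carrier N"
  note lin = bilinearD(1)[OF bilinear_pure[OF tensor_module[OF L M] N] z]
  show "f (pure R (tensor R L M) N s z) = g (pure R (tensor R L M) N s z)"
    by (rule tensor_ext[OF L M Q linear_map_comp[OF f lin] linear_map_comp[OF g lin] pures[OF _ _ z] s])
qed

end

text \<open>Both composites send the left-nested tensor of \<open>x\<close>, \<open>y\<close>,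
  \<open>z\<close> to the right-nested tensor of \<open>f x\<close>, \<open>g y\<close>,
  \<open>h z\<close>.\<close>

lemma tensor_assoc_natural:
  assumes mods: "module R L" "module R M" "module R N" and mods': "module R L'" "module R M'" "module R N'"
    and f: "linear_map R L L' f" and g: "linear_map R M M' g" and h: "linear_map R N N' h"
    and t: "t \<in> carrier (tensor R (tensor R L M) N)"
  shows "tensor_assoc R L' M' N' (tensor_map R (tensor R L' M') N' (tensor_map R L' M' f g) h t)
    = tensor_map R L' (tensor R M' N') f (tensor_map R M' N' g h) (tensor_assoc R L M N t)"
proof (rule tensor_ext_left_nested[OF mods _ _ _ _ t])
  note LM = tensor_module[OF mods(1,2)] and MN = tensor_module[OF mods(2,3)]
    and LM' = tensor_module[OF mods'(1,2)] and MN' = tensor_module[OF mods'(2,3)]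
  note fg = tensor_map_linear[OF mods(1,2) mods'(1,2) f g] and gh = tensor_map_linear[OF mods(2,3) mods'(2,3) g h]
  show "module R (tensor R L' (tensor R M' N'))"
    by (rule tensor_module[OF mods'(1) MN'])
  show "linear_map R (tensor R (tensor R L M) N) (tensor R L' (tensor R M' N'))
      (\<lambda>t. tensor_assoc R L' M' N' (tensor_map R (tensor R L' M') N' (tensor_map R L' M' f g) h t))"
    by (rule linear_map_comp[OF tensor_assoc_linear[OF mods'] tensor_map_linear[OF LM mods(3) LM' mods'(3) fg h]])
  show "linear_map R (tensor R (tensor R L M) N) (tensor R L' (tensor R M' N'))
      (\<lambda>t. tensor_map R L' (tensor R M' N') f (tensor_map R M' N' g h) (tensor_assoc R L M N t))"
    by (rule linear_map_comp[OF tensor_map_linear[OF mods(1) MN mods'(1) MN' f gh] tensor_assoc_linear[OF mods]])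
  fix x y z assume xyz: "x \<in> carrier L" "y \<in> carrier M" "z \<in> carrier N"
  then show "tensor_assoc R L' M' N' (tensor_map R (tensor R L' M') N' (tensor_map R L' M' f g) h
        (pure R (tensor R L M) N (pure R L M x y) z))
      = tensor_map R L' (tensor R M' N') f (tensor_map R M' N' g h)
        (tensor_assoc R L M N (pure R (tensor R L M) N (pure R L M x y) z))"
    by (simp add: tensor_map_pure[OF LM mods(3) LM' mods'(3) fg h] tensor_map_pure[OF mods(1,2) mods'(1,2) f g]
        tensor_assoc_pure[OF mods'] tensor_assoc_pure[OF mods] tensor_map_pure[OF mods(1) MN mods'(1) MN' f gh]
        tensor_map_pure[OF mods(2,3) mods'(2,3) g h] pure_closed[OF mods(1,2)] pure_closed[OF mods(2,3)]
        linear_mapD(1)[OF f] linear_mapD(1)[OF g] linear_mapD(1)[OF h])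
qed

section \<open>The ground ring as a module, and the unitors\<close>

lemma ground_space_simps [simp]:
  "carrier (ground_space R) = carrier R" "add (ground_space R) = add R"
  "smult (ground_space R) = mult R" "zero (ground_space R) = zero R"
  by (simp_all add: ground_space_def)

lemma ground_space_module:
  assumes "cring R"
  shows "module R (ground_space R)"
proof -
  interpret R: cring R by fact
  have "\<exists>y \<in> carrier R. y \<oplus>\<^bsub>R\<^esub> x = \<zero>\<^bsub>R\<^esub>" if "x \<in> carrier R" for x
    by (rule bexI[of _ "\<ominus>\<^bsub>R\<^esub> x"]) (simp_all add: that R.l_neg)
  then have "abelian_group (ground_space R)"
    by (intro abelian_groupI) (simp_all add: R.a_ac)
  then show ?thesis
    by (intro moduleI assms) (simp_all add: R.m_assoc R.l_distr R.r_distr)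
qed

context
  fixes R :: "('k, 'r) ring_scheme" and M :: "('k, 'a, 'm) module_scheme"
  assumes M: "module R M"
begin

interpretation M: module R M by (rule M)

private lemma smult_linear: "x \<in> carrier M \<Longrightarrow> linear_map R (ground_space R) M (\<lambda>k. k \<odot>\<^bsub>M\<^esub> x)"
  by (rule linear_mapI) (simp_all add: M.smult_l_distr M.smult_assoc1)

private lemma smult_bilinear:
  "bilinear R M (ground_space R) M (\<lambda>x k. k \<odot>\<^bsub>M\<^esub> x)" "bilinear R (ground_space R) M M (\<lambda>k x. k \<odot>\<^bsub>M\<^esub> x)"
  using linear_map_smult[OF M _ linear_map_id[unfolded id_def]]
  by (auto intro!: bilinearI smult_linear)

private lemma ground: "module R (ground_space R)"
  by (rule ground_space_module[OF M.R.is_cring])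

lemma right_unitor_linear: "linear_map R (tensor R M (ground_space R)) M (right_unitor R M)"
  unfolding right_unitor_def by (rule tensor_lift_linear[OF M ground M smult_bilinear(1)])

lemma left_unitor_linear: "linear_map R (tensor R (ground_space R) M) M (left_unitor R M)"
  unfolding left_unitor_def by (rule tensor_lift_linear[OF ground M M smult_bilinear(2)])

lemma right_unitor_pure:
  "x \<in> carrier M \<Longrightarrow> k \<in> carrier R \<Longrightarrow> right_unitor R M (pure R M (ground_space R) x k) = k \<odot>\<^bsub>M\<^esub> x"
  unfolding right_unitor_def by (rule tensor_lift_pure[OF M ground M smult_bilinear(1)]) simp_all

lemma left_unitor_pure:
  "k \<in> carrier R \<Longrightarrow> x \<in> carrier M \<Longrightarrow> left_unitor R M (pure R (ground_space R) M k x) = k \<odot>\<^bsub>M\<^esub> x"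
  unfolding left_unitor_def by (rule tensor_lift_pure[OF ground M M smult_bilinear(2)]) simp_all

end

section \<open>Twisting algebras and coalgebras\<close>

lemma commute_onD: "commute_on M f g \<Longrightarrow> x \<in> carrier M \<Longrightarrow> f (g x) = g (f x)"
  by (simp add: commute_on_def)

lemma commute_on_sym: "commute_on M f g \<Longrightarrow> commute_on M g f"
  by (simp add: commute_on_def)

lemma multiplicativeD:
  "multiplicative R A mu f \<Longrightarrow> a \<in> carrier A \<Longrightarrow> b \<in> carrier A \<Longrightarrow>
    f (prd R A mu a b) = prd R A mu (f a) (f b)"
  by (simp add: multiplicative_def)

lemma comultiplicativeD:
  "comultiplicative R C Delta f \<Longrightarrow> c \<in> carrier C \<Longrightarrow> tensor_map R C C f f (Delta c) = Delta (f c)"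
  by (simp add: comultiplicative_def)

section \<open>Twisting a multiplication\<close>

lemma prd_bilinear:
  assumes "module R A" and "linear_map R (tensor R A A) A mu"
  shows "bilinear R A A A (prd R A mu)"
  using linear_comp_bilinear[OF assms(2) bilinear_pure[OF assms(1,1)]]
  by (simp add: prd_def[abs_def])

context
  fixes R :: "('k, 'r) ring_scheme" and A :: "('k, 'a, 'm) module_scheme" and mu alpha beta
  assumes A: "module R A" and mu: "linear_map R (tensor R A A) A mu"
    and alpha: "linear_map R A A alpha" and beta: "linear_map R A A beta"
begin

lemma twisted_mult_linear: "linear_map R (tensor R A A) A (twisted_mult R A mu alpha beta)"
  unfolding twisted_mult_def comp_def
  by (rule linear_map_comp[OF mu tensor_map_linear[OF A A A A alpha beta]])

lemma prd_twisted_mult: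
  "a \<in> carrier A \<Longrightarrow> b \<in> carrier A \<Longrightarrow>
    prd R A (twisted_mult R A mu alpha beta) a b = prd R A mu (alpha a) (beta b)"
  by (simp add: prd_def twisted_mult_def tensor_map_pure[OF A A A A alpha beta])

text \<open>Since \<open>f\<close> is multiplicative, it sends the product of \<alpha>(a) and
  \<beta>(b) to that of f(\<alpha>(a)) and f(\<beta>(b)); commutation then moves \<open>f\<close>
  inside. The map \<open>f\<close> is kept general because it stands for \<alpha> and \<beta> in the
  algebra case and for \<psi> and \<omega> in the bialgebra case.\<close>

lemma multiplicative_twisted_mult:
  assumes f: "linear_map R A A f" and "multiplicative R A mu f"
    and "commute_on A f alpha" and "commute_on A f beta"
  shows "multiplicative R A (twisted_mult R A mu alpha beta) f"
  unfolding multiplicative_def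
  using assms(2-)
  by (simp add: prd_twisted_mult multiplicativeD commute_onD[of A f] linear_mapD(1)[OF alpha]
      linear_mapD(1)[OF beta] linear_mapD(1)[OF f])

end

context assoc_algebra
begin

lemma prd_closed: "a \<in> carrier A \<Longrightarrow> b \<in> carrier A \<Longrightarrow> prd R A mu a b \<in> carrier A"
  by (rule linear_mapD(1)[OF bilinearD(2)[OF prd_bilinear[OF module_axioms mu_linear]]])

text \<open>Expanding the twisted product, the left side of BiHom-associativity multiplies
  \<alpha>\<alpha>(a) by the product of \<beta>\<alpha>(b) and \<beta>\<beta>(c), while the right
  side multiplies the product of \<alpha>\<alpha>(a) and \<alpha>\<beta>(b) by \<beta>\<beta>(c).
  Associativity and commutation identify them.\<close>

lemma bihom_assoc_algebra_twist:
  assumes "algebra_endo R A mu alpha" and "algebra_endo R A mu beta" and comm: "commute_on A alpha beta"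
  shows "bihom_assoc_algebra R A (twisted_mult R A mu alpha beta) alpha beta"
proof -
  have alpha: "linear_map R A A alpha" "multiplicative R A mu alpha"
    and beta: "linear_map R A A beta" "multiplicative R A mu beta"
    using assms by (simp_all add: algebra_endo_def)
  note twist = module_axioms mu_linear alpha(1) beta(1)
  note closed = prd_closed linear_mapD(1)[OF alpha(1)] linear_mapD(1)[OF beta(1)]
  \<comment> \<open>Multiplicativity for the twisted product asks a map to commute with both
    \<alpha> and \<beta>, including itself.\<close>
  have self: "commute_on A f f" for f by (simp add: commute_on_def)
  show ?thesis
  proof unfold_locales
    fix a b c assume "a \<in> carrier A" "b \<in> carrier A" "c \<in> carrier A"
    then show "prd R A (twisted_mult R A mu alpha beta) (alpha a) (prd R A (twisted_mult R A mu alpha beta) b c) =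
        prd R A (twisted_mult R A mu alpha beta) (prd R A (twisted_mult R A mu alpha beta) a b) (beta c)"
      by (simp add: prd_twisted_mult[OF twist] closed multiplicativeD[OF alpha(2)] multiplicativeD[OF beta(2)]
          mu_assoc commute_onD[OF comm])
  qed (intro twisted_mult_linear[OF twist] multiplicative_twisted_mult[OF twist] alpha beta comm
      commute_on_sym[OF comm] self)+
qed

end

text \<open>Because \<beta> fixes \<open>u\<close>, the twisted product of \<open>a\<close> with
  \<open>u\<close> is \<alpha>(a) times the old unit, that is \<alpha>(a). The other side is
  symmetric and uses that \<alpha> fixes \<open>u\<close>.\<close>

lemma (in unital_assoc_algebra) unital_bihom_assoc_algebra_twist:
  assumes "unital_algebra_endo R A mu u alpha" and "unital_algebra_endo R A mu u beta"
    and comm: "commute_on A alpha beta"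
  shows "unital_bihom_assoc_algebra R A (twisted_mult R A mu alpha beta) alpha beta u"
proof -
  have endo: "algebra_endo R A mu alpha" "algebra_endo R A mu beta" and u: "alpha u = u" "beta u = u"
    using assms by (simp_all add: unital_algebra_endo_def)
  then have lin: "linear_map R A A alpha" "linear_map R A A beta"
    by (simp_all add: algebra_endo_def)
  interpret twisted: bihom_assoc_algebra R A "twisted_mult R A mu alpha beta" alpha beta
    by (rule bihom_assoc_algebra_twist[OF endo comm])
  show ?thesis
    by unfold_locales
      (simp_all add: u unit_closed unit_left unit_right prd_twisted_mult[OF module_axioms mu_linear lin]
        linear_mapD(1)[OF lin(1)] linear_mapD(1)[OF lin(2)])
qed

section \<open>Twisting a comultiplication\<close>

context
  fixes R :: "('k, 'r) ring_scheme" and C :: "('k, 'c, 'm) module_scheme" and Delta psi omega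
  assumes C: "module R C" and Delta: "linear_map R C (tensor R C C) Delta"
    and psi: "linear_map R C C psi" and omega: "linear_map R C C omega"
begin

lemma twisted_comult_linear: "linear_map R C (tensor R C C) (twisted_comult R C Delta psi omega)"
  unfolding twisted_comult_def comp_def
  by (rule linear_map_comp[OF tensor_map_linear[OF C C C C omega psi] Delta])

text \<open>Commutation lets f \<otimes> f slide past \<omega> \<otimes> \<psi> on each leg, after
  which it meets \<Delta> and is absorbed by comultiplicativity.\<close>

lemma comultiplicative_twisted_comult:
  assumes f: "linear_map R C C f" and f_comult: "comultiplicative R C Delta f"
    and psi_comm: "commute_on C f psi" and omega_comm: "commute_on C f omega"
  shows "comultiplicative R C (twisted_comult R C Delta psi omega) f"
  unfolding comultiplicative_def
proof
  fix c assume c: "c \<in> carrier C"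
  note comp = tensor_map_comp[OF C C C C C C _ _ _ _ _ _ linear_mapD(1)[OF Delta c]]
  have "tensor_map R C C f f (twisted_comult R C Delta psi omega c)
      = tensor_map R C C (\<lambda>x. omega (f x)) (\<lambda>x. psi (f x)) (Delta c)"
    unfolding twisted_comult_def comp_def
    by (rule comp[OF omega psi f f commute_onD[OF omega_comm] commute_onD[OF psi_comm]])
  also have "\<dots> = tensor_map R C C omega psi (tensor_map R C C f f (Delta c))"
    by (rule comp[OF f f omega psi refl refl, symmetric])
  also have "\<dots> = twisted_comult R C Delta psi omega (f c)"
    by (simp add: twisted_comult_def comultiplicativeD[OF f_comult c])
  finally show "tensor_map R C C f f (twisted_comult R C Delta psi omega c)
      = twisted_comult R C Delta psi omega (f c)" .
qed

end

context coassoc_coalgebra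
begin

lemma bihom_coassoc_twist:
  assumes psi: "linear_map R C C psi" "comultiplicative R C Delta psi"
    and omega: "linear_map R C C omega" "comultiplicative R C Delta omega"
    and comm: "commute_on C psi omega" and c: "c \<in> carrier C"
  defines "D \<equiv> twisted_comult R C Delta psi omega"
  shows "tensor_assoc R C C C (tensor_map R (tensor R C C) C D psi (D c)) =
    tensor_map R C (tensor R C C) omega D (D c)"
proof -
  note C = module_axioms
  note CC = tensor_module[OF C C]
  note Delta_closed = linear_mapD(1)[OF Delta_linear]
  note D_lin = twisted_comult_linear[OF C Delta_linear psi(1) omega(1), folded D_def]
  \<comment> \<open>These maps act on the three legs once both sides are written through \<Delta>.
    The middle leg receives \<psi>\<omega> on one side and \<omega>\<psi> on the other; commutation
    enters in \<open>D_psi\<close>, where the two are identified.\<close>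
  define oo where "oo = (\<lambda>x. omega (omega x))"
  define po where "po = (\<lambda>x. psi (omega x))"
  define pp where "pp = (\<lambda>x. psi (psi x))"
  have lin: "linear_map R C C oo" "linear_map R C C po" "linear_map R C C pp"
    unfolding oo_def po_def pp_def
    by (rule linear_map_comp[OF omega(1) omega(1)] linear_map_comp[OF psi(1) omega(1)]
        linear_map_comp[OF psi(1) psi(1)])+
  note oo_po = tensor_map_linear[OF C C C C lin(1,2)] and po_pp = tensor_map_linear[OF C C C C lin(2,3)]
  have D_omega: "D (omega x) = tensor_map R C C oo po (Delta x)" if x: "x \<in> carrier C" for x
    using tensor_map_comp[OF C C C C C C omega(1) omega(1) omega(1) psi(1) refl refl Delta_closed[OF x]]
    by (simp add: D_def twisted_comult_def oo_def po_def comultiplicativeD[OF omega(2) x])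
  have D_psi: "D (psi x) = tensor_map R C C po pp (Delta x)" if x: "x \<in> carrier C" for x
    using tensor_map_comp[OF C C C C C C psi(1) psi(1) omega(1) psi(1)
        commute_onD[OF comm, symmetric] refl Delta_closed[OF x]]
    by (simp add: D_def twisted_comult_def po_def pp_def comultiplicativeD[OF psi(2) x])
  have D_c: "D c = tensor_map R C C omega psi (Delta c)"
    by (simp add: D_def twisted_comult_def)
  \<comment> \<open>On the first leg of \<Delta>(c) the twisted comultiplication follows \<omega>,
    so \<open>D_omega\<close> applies; the last leg collects \<psi> twice.\<close>
  have "tensor_map R (tensor R C C) C D psi (D c)
      = tensor_map R (tensor R C C) C (\<lambda>x. tensor_map R C C oo po (Delta x)) pp (Delta c)"
    unfolding D_c
    by (rule tensor_map_comp[OF C C C C CC C omega(1) psi(1) D_lin psi(1) D_omega _ Delta_closed[OF c]])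
      (simp_all add: pp_def)
  \<comment> \<open>Functoriality read backwards splits off \<Delta> \<otimes> id, so that
    naturality of the associator can bring the original coassociativity into play.\<close>
  also have "\<dots> = tensor_map R (tensor R C C) C (tensor_map R C C oo po) pp
      (tensor_map R (tensor R C C) C Delta id (Delta c))"
    by (rule tensor_map_comp[OF C C CC C CC C Delta_linear linear_map_id oo_po lin(3) refl _ Delta_closed[OF c], symmetric])
      simp
  finally have "tensor_assoc R C C C (tensor_map R (tensor R C C) C D psi (D c)) =
      tensor_assoc R C C C (tensor_map R (tensor R C C) C (tensor_map R C C oo po) pp
        (tensor_map R (tensor R C C) C Delta id (Delta c)))"
    by (rule arg_cong)
  also have "\<dots> = tensor_map R C (tensor R C C) oo (tensor_map R C C po pp)
      (tensor_assoc R C C C (tensor_map R (tensor R C C) C Delta id (Delta c)))"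
    by (rule tensor_assoc_natural[OF C C C C C C lin
          tensor_map_closed[OF C C CC C Delta_linear linear_map_id Delta_closed[OF c]]])
  also have "\<dots> = tensor_map R C (tensor R C C) oo (tensor_map R C C po pp)
      (tensor_map R C (tensor R C C) id Delta (Delta c))"
    by (simp only: Delta_coassoc[OF c])
  also have "\<dots> = tensor_map R C (tensor R C C) oo (\<lambda>x. tensor_map R C C po pp (Delta x)) (Delta c)"
    by (rule tensor_map_comp[OF C C C CC C CC linear_map_id Delta_linear lin(1) po_pp _ refl Delta_closed[OF c]])
      simp
  \<comment> \<open>Again backwards: \<open>D_psi\<close> turns the second leg into the twisted
    comultiplication after \<psi>, and \<omega> \<otimes> \<psi> is split off to rebuild
    \<open>D c\<close>.\<close>
  also have "\<dots> = tensor_map R C (tensor R C C) omega D (tensor_map R C C omega psi (Delta c))"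
    by (rule tensor_map_comp[OF C C C C C CC omega(1) psi(1) omega(1) D_lin _ D_psi Delta_closed[OF c], symmetric])
      (simp_all add: oo_def)
  finally show ?thesis
    unfolding D_c .
qed

lemma bihom_coassoc_coalgebra_twist:
  assumes "coalgebra_endo R C Delta psi" and "coalgebra_endo R C Delta omega" and comm: "commute_on C psi omega"
  shows "bihom_coassoc_coalgebra R C (twisted_comult R C Delta psi omega) psi omega"
proof -
  have psi: "linear_map R C C psi" "comultiplicative R C Delta psi"
    and omega: "linear_map R C C omega" "comultiplicative R C Delta omega"
    using assms by (simp_all add: coalgebra_endo_def)
  note twist = module_axioms Delta_linear psi(1) omega(1)
  have self: "commute_on C f f" for f by (simp add: commute_on_def)
  show ?thesis
    by unfold_locales
      (intro twisted_comult_linear[OF twist] comultiplicative_twisted_comult[OF twist] psi omega comm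
        commute_on_sym[OF comm] self bihom_coassoc_twist; assumption)+
qed

end

text \<open>Applying the counit to the second leg absorbs \<psi> and leaves \<omega> on the first,
  which then passes through the unitor by linearity. The original counit axiom thus yields
  \<omega>(c); on the other side the roles of \<psi> and \<omega> are exchanged.\<close>

lemma (in counital_coassoc_coalgebra) counital_bihom_coassoc_coalgebra_twist:
  assumes "counital_coalgebra_endo R C Delta eps psi" and "counital_coalgebra_endo R C Delta eps omega"
    and comm: "commute_on C psi omega"
  shows "counital_bihom_coassoc_coalgebra R C (twisted_comult R C Delta psi omega) psi omega eps"
proof -
  have endo: "coalgebra_endo R C Delta psi" "coalgebra_endo R C Delta omega"
    and eps: "\<And>c. c \<in> carrier C \<Longrightarrow> eps (psi c) = eps c" "\<And>c. c \<in> carrier C \<Longrightarrow> eps (omega c) = eps c"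
    using assms by (simp_all add: counital_coalgebra_endo_def)
  then have psi: "linear_map R C C psi" and omega: "linear_map R C C omega"
    by (simp_all add: coalgebra_endo_def)
  interpret twisted: bihom_coassoc_coalgebra R C "twisted_comult R C Delta psi omega" psi omega
    by (rule bihom_coassoc_coalgebra_twist[OF endo comm])
  note C = module_axioms and k = ground_space_module[OF is_cring]
  note id_eps = tensor_map_linear[OF C C C k linear_map_id eps_linear]
    and eps_id = tensor_map_linear[OF C C k C eps_linear linear_map_id]
    and omega_psi = tensor_map_linear[OF C C C C omega psi]
  note closed = linear_mapD(1)[OF omega] linear_mapD(1)[OF psi] linear_mapD(1)[OF eps_linear, simplified]
  \<comment> \<open>The claim is made for every tensor, since \<open>Delta c\<close> need not be
    pure. Both sides are linear in \<open>t\<close>, so pure tensors decide.\<close>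
  have right: "right_unitor R C (tensor_map R C (ground_space R) id eps (tensor_map R C C omega psi t))
      = omega (right_unitor R C (tensor_map R C (ground_space R) id eps t))"
    if t: "t \<in> carrier (tensor R C C)" for t
  proof (rule tensor_ext[OF C C C linear_map_comp[OF right_unitor_linear[OF C] linear_map_comp[OF id_eps omega_psi]]
        linear_map_comp[OF omega linear_map_comp[OF right_unitor_linear[OF C] id_eps]] _ t])
    fix x y assume "x \<in> carrier C" "y \<in> carrier C"
    then show "right_unitor R C (tensor_map R C (ground_space R) id eps (tensor_map R C C omega psi (pure R C C x y)))
        = omega (right_unitor R C (tensor_map R C (ground_space R) id eps (pure R C C x y)))"
      by (simp add: tensor_map_pure[OF C C C C omega psi] tensor_map_pure[OF C C C k linear_map_id eps_linear]
          right_unitor_pure[OF C] closed eps linear_mapD(3)[OF omega])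
  qed
  have left: "left_unitor R C (tensor_map R (ground_space R) C eps id (tensor_map R C C omega psi t))
      = psi (left_unitor R C (tensor_map R (ground_space R) C eps id t))"
    if t: "t \<in> carrier (tensor R C C)" for t
  proof (rule tensor_ext[OF C C C linear_map_comp[OF left_unitor_linear[OF C] linear_map_comp[OF eps_id omega_psi]]
        linear_map_comp[OF psi linear_map_comp[OF left_unitor_linear[OF C] eps_id]] _ t])
    fix x y assume "x \<in> carrier C" "y \<in> carrier C"
    then show "left_unitor R C (tensor_map R (ground_space R) C eps id (tensor_map R C C omega psi (pure R C C x y)))
        = psi (left_unitor R C (tensor_map R (ground_space R) C eps id (pure R C C x y)))"
      by (simp add: tensor_map_pure[OF C C C C omega psi] tensor_map_pure[OF C C k C eps_linear linear_map_id]
          left_unitor_pure[OF C] closed eps linear_mapD(3)[OF psi])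
  qed
  show ?thesis
    by unfold_locales
      (simp_all add: eps eps_linear twisted_comult_def right left linear_mapD(1)[OF Delta_linear]
        counit_right counit_left)
qed

section \<open>Twisting bialgebras\<close>

context
  fixes R :: "('k, 'r) ring_scheme" and A :: "('k, 'a, 'm) module_scheme" and mu
  assumes A: "module R A" and mu: "linear_map R (tensor R A A) A mu"
begin

private lemma AA: "module R (tensor R A A)"
  by (rule tensor_module[OF A A])

private lemma prd_inner_bilinear:
  "x \<in> carrier A \<Longrightarrow> y \<in> carrier A \<Longrightarrow>
    bilinear R A A (tensor R A A) (\<lambda>x' y'. pure R A A (prd R A mu x x') (prd R A mu y y'))"
  by (intro bilinear_pure_comp A bilinearD(2)[OF prd_bilinear[OF A mu]])

private lemma prd_outer_bilinear:
  assumes t: "t \<in> carrier (tensor R A A)"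
  shows "bilinear R A A (tensor R A A) (\<lambda>x y.
    tensor_lift R (tensor R A A) (\<lambda>x' y'. pure R A A (prd R A mu x x') (prd R A mu y y')) t)"
proof (rule bilinearI)
  note prd = bilinearD[OF prd_bilinear[OF A mu]]
  note closed = linear_mapD(1)[OF prd(2)] and pure = bilinearD[OF bilinear_pure[OF A A]]
  \<comment> \<open>In the first claim \<open>z\<close> is the fixed second leg of the left factor,
    in the second claim the fixed first leg; in both the other leg is the linear parameter.\<close>
  fix z assume z: "z \<in> carrier A"
  show "linear_map R A (tensor R A A) (\<lambda>x.
      tensor_lift R (tensor R A A) (\<lambda>x' y'. pure R A A (prd R A mu x x') (prd R A mu z y')) t)"
    by (rule tensor_lift_linear_parameter[OF A A A AA prd_inner_bilinear[OF _ z] _ t])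
      (assumption | rule linear_map_comp[OF pure(1)[OF closed[OF z]] prd(1)])+
  show "linear_map R A (tensor R A A) (\<lambda>y.
      tensor_lift R (tensor R A A) (\<lambda>x' y'. pure R A A (prd R A mu z x') (prd R A mu y y')) t)"
    by (rule tensor_lift_linear_parameter[OF A A A AA prd_inner_bilinear[OF z] _ t])
      (assumption | rule linear_map_comp[OF pure(2)[OF closed[OF z]] prd(1)])+
qed

text \<open>Linearity in \<open>s\<close> is that of the outer lift. For linearity in
  \<open>t\<close>, that tensor is treated as the parameter of the outer lift, on which the inner
  lift depends linearly.\<close>

lemma tensor_prd_bilinear:
  "bilinear R (tensor R A A) (tensor R A A) (tensor R A A) (tensor_prd R A mu)"
  unfolding tensor_prd_def
proof (rule bilinearI)
  fix t assume "t \<in> carrier (tensor R A A)"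
  then show "linear_map R (tensor R A A) (tensor R A A) (\<lambda>s. tensor_lift R (tensor R A A) (\<lambda>x y.
      tensor_lift R (tensor R A A) (\<lambda>x' y'. pure R A A (prd R A mu x x') (prd R A mu y y')) t) s)"
    by (rule tensor_lift_linear[OF A A AA prd_outer_bilinear])
next
  fix s assume s: "s \<in> carrier (tensor R A A)"
  show "linear_map R (tensor R A A) (tensor R A A) (\<lambda>t. tensor_lift R (tensor R A A) (\<lambda>x y.
      tensor_lift R (tensor R A A) (\<lambda>x' y'. pure R A A (prd R A mu x x') (prd R A mu y y')) t) s)"
    by (rule tensor_lift_linear_parameter[OF A A AA AA prd_outer_bilinear _ s])
      (assumption | rule tensor_lift_linear[OF A A AA prd_inner_bilinear])+
qed

lemma tensor_prd_pure:
  assumes "x \<in> carrier A" "y \<in> carrier A" "x' \<in> carrier A" "y' \<in> carrier A"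
  shows "tensor_prd R A mu (pure R A A x y) (pure R A A x' y')
    = pure R A A (prd R A mu x x') (prd R A mu y y')"
  unfolding tensor_prd_def
  by (simp add: assms pure_closed[OF A A] tensor_lift_pure[OF A A AA prd_outer_bilinear]
      tensor_lift_pure[OF A A AA prd_inner_bilinear])

text \<open>Both sides are bilinear, and on pure tensors multiplicativity on each leg gives the
  result. The two legs may carry different maps, as needed for \<omega> \<otimes> \<psi>.\<close>

lemma tensor_map_tensor_prd:
  assumes f: "linear_map R A A f" "multiplicative R A mu f" and g: "linear_map R A A g" "multiplicative R A mu g"
    and s: "s \<in> carrier (tensor R A A)" and t: "t \<in> carrier (tensor R A A)"
  shows "tensor_map R A A f g (tensor_prd R A mu s t)
    = tensor_prd R A mu (tensor_map R A A f g s) (tensor_map R A A f g t)"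
proof (rule bilinear_tensor_ext[OF A A A A AA _ _ _ s t])
  note fg = tensor_map_linear[OF A A A A f(1) g(1)]
  show "bilinear R (tensor R A A) (tensor R A A) (tensor R A A)
      (\<lambda>s t. tensor_map R A A f g (tensor_prd R A mu s t))"
    by (rule linear_comp_bilinear[OF fg tensor_prd_bilinear])
  show "bilinear R (tensor R A A) (tensor R A A) (tensor R A A)
      (\<lambda>s t. tensor_prd R A mu (tensor_map R A A f g s) (tensor_map R A A f g t))"
    by (rule bilinear_comp[OF tensor_prd_bilinear fg fg])
qed (simp add: tensor_prd_pure tensor_map_pure[OF A A A A f(1) g(1)] multiplicativeD[OF f(2)]
    multiplicativeD[OF g(2)] linear_mapD(1)[OF bilinearD(2)[OF prd_bilinear[OF A mu]]]
    linear_mapD(1)[OF f(1)] linear_mapD(1)[OF g(1)])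

end

text \<open>On pure tensors each leg carries \<alpha> of a left factor times \<beta> of a right
  factor. This reduces the twisted componentwise product to the original one.\<close>

lemma tensor_prd_twisted_mult:
  assumes A: "module R A" and mu: "linear_map R (tensor R A A) A mu"
    and alpha: "linear_map R A A alpha" and beta: "linear_map R A A beta"
    and s: "s \<in> carrier (tensor R A A)" and t: "t \<in> carrier (tensor R A A)"
  shows "tensor_prd R A (twisted_mult R A mu alpha beta) s t
    = tensor_prd R A mu (tensor_map R A A alpha alpha s) (tensor_map R A A beta beta t)"
proof (rule bilinear_tensor_ext[OF A A A A tensor_module[OF A A] _ _ _ s t])
  note twist = twisted_mult_linear[OF A mu alpha beta]
  show "bilinear R (tensor R A A) (tensor R A A) (tensor R A A) (tensor_prd R A (twisted_mult R A mu alpha beta))"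
    by (rule tensor_prd_bilinear[OF A twist])
  show "bilinear R (tensor R A A) (tensor R A A) (tensor R A A)
      (\<lambda>s t. tensor_prd R A mu (tensor_map R A A alpha alpha s) (tensor_map R A A beta beta t))"
    by (rule bilinear_comp[OF tensor_prd_bilinear[OF A mu] tensor_map_linear[OF A A A A alpha alpha]
          tensor_map_linear[OF A A A A beta beta]])
qed (simp add: tensor_prd_pure[OF A mu] tensor_prd_pure[OF A twisted_mult_linear[OF A mu alpha beta]]
    prd_twisted_mult[OF A mu alpha beta] tensor_map_pure[OF A A A A alpha alpha]
    tensor_map_pure[OF A A A A beta beta] linear_mapD(1)[OF alpha] linear_mapD(1)[OF beta])

text \<open>The twisted product is the old product of \<alpha>(h) and \<beta>(h'). Multiplicativity
  of \<Delta> and of \<omega> \<otimes> \<psi> distributes the twisted comultiplication over it, and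
  \<alpha> and \<beta> are then pulled out and absorbed into the twisted componentwise
  product.\<close>

lemma (in bialgebra) comult_multiplicative_twist:
  assumes alpha: "linear_map R H H alpha" "comultiplicative R H Delta alpha"
    and beta: "linear_map R H H beta" "comultiplicative R H Delta beta"
    and psi: "linear_map R H H psi" "multiplicative R H mu psi"
    and omega: "linear_map R H H omega" "multiplicative R H mu omega"
    and comm: "commute_on H alpha psi" "commute_on H alpha omega" "commute_on H beta psi" "commute_on H beta omega"
  shows "comult_multiplicative R H (twisted_mult R H mu alpha beta) (twisted_comult R H Delta psi omega)"
  unfolding comult_multiplicative_def
proof (intro ballI)
  note H = module_axioms
  note Delta_closed = linear_mapD(1)[OF Delta_linear]
  let ?D = "twisted_comult R H Delta psi omega"
  have D: "?D x = tensor_map R H H omega psi (Delta x)" for x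
    by (simp add: twisted_comult_def)
  have D_closed: "?D x \<in> carrier (tensor R H H)" if "x \<in> carrier H" for x
    by (rule linear_mapD(1)[OF twisted_comult_linear[OF H Delta_linear psi(1) omega(1)] that])
  \<comment> \<open>Commuting with \<psi> and \<omega>, the maps \<alpha> and \<beta> are
    comultiplicative for the twisted comultiplication too.\<close>
  note D_comult = comultiplicativeD[OF comultiplicative_twisted_comult[OF H Delta_linear psi(1) omega(1)]]
  fix h h' assume h: "h \<in> carrier H" and h': "h' \<in> carrier H"
  then have ab: "alpha h \<in> carrier H" "beta h' \<in> carrier H"
    by (simp_all add: linear_mapD(1)[OF alpha(1)] linear_mapD(1)[OF beta(1)])
  have "?D (prd R H (twisted_mult R H mu alpha beta) h h') = ?D (prd R H mu (alpha h) (beta h'))"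
    by (simp add: prd_twisted_mult[OF H mu_linear alpha(1) beta(1)] h h')
  also have "\<dots> = tensor_map R H H omega psi (tensor_prd R H mu (Delta (alpha h)) (Delta (beta h')))"
    using Delta_mult ab by (simp add: D comult_multiplicative_def)
  also have "\<dots> = tensor_prd R H mu (?D (alpha h)) (?D (beta h'))"
    unfolding D by (rule tensor_map_tensor_prd[OF H mu_linear omega psi Delta_closed[OF ab(1)] Delta_closed[OF ab(2)]])
  also have "\<dots> = tensor_prd R H mu (tensor_map R H H alpha alpha (?D h)) (tensor_map R H H beta beta (?D h'))"
    by (simp only: D_comult[OF alpha comm(1,2) h] D_comult[OF beta comm(3,4) h'])
  also have "\<dots> = tensor_prd R H (twisted_mult R H mu alpha beta) (?D h) (?D h')"
    by (rule tensor_prd_twisted_mult[OF H mu_linear alpha(1) beta(1) D_closed[OF h] D_closed[OF h'], symmetric])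
  finally show "?D (prd R H (twisted_mult R H mu alpha beta) h h')
      = tensor_prd R H (twisted_mult R H mu alpha beta) (?D h) (?D h')" .
qed

lemma (in bialgebra) bihom_bialgebra_twist:
  assumes "bialgebra_endo R H mu Delta alpha" "bialgebra_endo R H mu Delta beta"
    and "bialgebra_endo R H mu Delta psi" "bialgebra_endo R H mu Delta omega"
    and comm: "commute_on H alpha beta" "commute_on H alpha psi" "commute_on H alpha omega"
      "commute_on H beta psi" "commute_on H beta omega" "commute_on H psi omega"
  shows "bihom_bialgebra R H (twisted_mult R H mu alpha beta) (twisted_comult R H Delta psi omega)
    alpha beta psi omega"
proof -
  have endos: "algebra_endo R H mu alpha" "algebra_endo R H mu beta"
      "coalgebra_endo R H Delta psi" "coalgebra_endo R H Delta omega"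
    and alpha: "linear_map R H H alpha" "comultiplicative R H Delta alpha"
    and beta: "linear_map R H H beta" "comultiplicative R H Delta beta"
    and psi: "linear_map R H H psi" "multiplicative R H mu psi"
    and omega: "linear_map R H H omega" "multiplicative R H mu omega"
    using assms by (simp_all add: bialgebra_endo_def algebra_endo_def coalgebra_endo_def)
  interpret alg: bihom_assoc_algebra R H "twisted_mult R H mu alpha beta" alpha beta
    by (rule bihom_assoc_algebra_twist[OF endos(1,2) comm(1)])
  interpret coalg: bihom_coassoc_coalgebra R H "twisted_comult R H Delta psi omega" psi omega
    by (rule bihom_coassoc_coalgebra_twist[OF endos(3,4) comm(6)])
  note mult = multiplicative_twisted_mult[OF module_axioms mu_linear alpha(1) beta(1)]
    and comult = comultiplicative_twisted_comult[OF module_axioms Delta_linear psi(1) omega(1)]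
  show ?thesis
    by unfold_locales
      \<comment> \<open>The reversed commutation facts serve \<psi> and \<omega> as multiplicative
        maps for the twisted product; the unreversed ones serve \<alpha> and \<beta> as
        comultiplicative maps.\<close>
      (intro comult_multiplicative_twist mult comult alpha beta psi omega comm
        comm(2-5)[THEN commute_on_sym])+
qed

theorem proposition5p9:
  fixes R :: "('k, 'r) ring_scheme"
    and A :: "('k, 'a, 'm) module_scheme"
    and C :: "('k, 'c, 'n) module_scheme"
    and H :: "('k, 'h, 'p) module_scheme"
  shows
    "(\<forall>mu alpha beta.
        assoc_algebra R A mu \<and> algebra_endo R A mu alpha \<and> algebra_endo R A mu beta \<and>
        commute_on A alpha beta \<longrightarrow>
          bihom_assoc_algebra R A (twisted_mult R A mu alpha beta) alpha beta \<and>
          (\<forall>u. unital_assoc_algebra R A mu u \<and>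
               unital_algebra_endo R A mu u alpha \<and> unital_algebra_endo R A mu u beta \<longrightarrow>
               unital_bihom_assoc_algebra R A (twisted_mult R A mu alpha beta) alpha beta u)) \<and>
     (\<forall>Delta psi omega.
        coassoc_coalgebra R C Delta \<and> coalgebra_endo R C Delta psi \<and> coalgebra_endo R C Delta omega \<and>
        commute_on C psi omega \<longrightarrow>
          bihom_coassoc_coalgebra R C (twisted_comult R C Delta psi omega) psi omega \<and>
          (\<forall>eps. counital_coassoc_coalgebra R C Delta eps \<and>
               counital_coalgebra_endo R C Delta eps psi \<and> counital_coalgebra_endo R C Delta eps omega \<longrightarrow>
               counital_bihom_coassoc_coalgebra R C (twisted_comult R C Delta psi omega) psi omega eps)) \<and>
     (\<forall>mu Delta alpha beta psi omega.
        bialgebra R H mu Delta \<and>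
        bialgebra_endo R H mu Delta alpha \<and> bialgebra_endo R H mu Delta beta \<and>
        bialgebra_endo R H mu Delta psi \<and> bialgebra_endo R H mu Delta omega \<and>
        commute_on H alpha beta \<and> commute_on H alpha psi \<and> commute_on H alpha omega \<and>
        commute_on H beta psi \<and> commute_on H beta omega \<and> commute_on H psi omega \<longrightarrow>
          bihom_bialgebra R H (twisted_mult R H mu alpha beta) (twisted_comult R H Delta psi omega)
            alpha beta psi omega)"
proof (intro conjI allI impI; elim conjE)
  fix mu alpha beta
  assume "assoc_algebra R A mu" "algebra_endo R A mu alpha" "algebra_endo R A mu beta" "commute_on A alpha beta"
  then show "bihom_assoc_algebra R A (twisted_mult R A mu alpha beta) alpha beta"
    by (rule assoc_algebra.bihom_assoc_algebra_twist)
next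
  fix mu alpha beta u
  assume "commute_on A alpha beta" "unital_assoc_algebra R A mu u"
    "unital_algebra_endo R A mu u alpha" "unital_algebra_endo R A mu u beta"
  then show "unital_bihom_assoc_algebra R A (twisted_mult R A mu alpha beta) alpha beta u"
    by (intro unital_assoc_algebra.unital_bihom_assoc_algebra_twist)
next
  fix Delta psi omega
  assume "coassoc_coalgebra R C Delta" "coalgebra_endo R C Delta psi" "coalgebra_endo R C Delta omega"
    "commute_on C psi omega"
  then show "bihom_coassoc_coalgebra R C (twisted_comult R C Delta psi omega) psi omega"
    by (rule coassoc_coalgebra.bihom_coassoc_coalgebra_twist)
next
  fix Delta psi omega eps
  assume "commute_on C psi omega" "counital_coassoc_coalgebra R C Delta eps"
    "counital_coalgebra_endo R C Delta eps psi" "counital_coalgebra_endo R C Delta eps omega"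
  then show "counital_bihom_coassoc_coalgebra R C (twisted_comult R C Delta psi omega) psi omega eps"
    by (intro counital_coassoc_coalgebra.counital_bihom_coassoc_coalgebra_twist)
next
  fix mu Delta alpha beta psi omega
  assume "bialgebra R H mu Delta"
    "bialgebra_endo R H mu Delta alpha" "bialgebra_endo R H mu Delta beta"
    "bialgebra_endo R H mu Delta psi" "bialgebra_endo R H mu Delta omega"
    "commute_on H alpha beta" "commute_on H alpha psi" "commute_on H alpha omega"
    "commute_on H beta psi" "commute_on H beta omega" "commute_on H psi omega"
  then show "bihom_bialgebra R H (twisted_mult R H mu alpha beta) (twisted_comult R H Delta psi omega)
      alpha beta psi omega"
    by (rule bialgebra.bihom_bialgebra_twist)
qed

end
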